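(* Let $\mathcal{C}$ be a one-dimensional asymptotic class in a countable language $\mathcal{L}$, and let $\mathcal{M}=\prod_{i\in I}M_i/\mathcal{U}$ be an infinite ultraproduct of members $M_i\in\mathcal{C}$. Then there exists an exact pseudofinite $H$-expansion of $\mathcal{M}$, i.e. there are subsets $H_i\subseteq M_i$ ($i\in I$) such that $\prod_{i\in I}(M_i,H_i)/\mathcal{U}$ is an $H$-expansion of $\mathcal{M}$.
   Context: A class $\mathcal{C}$ of finite $\mathcal{L}$-structures is a one-dimensional asymptotic class if for every $m$ and every $\mathcal{L}$-formula $\varphi(x;\bar y)$ with $|\bar y|=m$ ($x$ a single variable): there are $C>0$ and a finite $E\subseteq\mathbb{R}^{>0}$ such that for all $M\in\mathcal{C}$, $\bar b\in M^m$, either $|\varphi(M;\bar b)|<C$ or $\big||\varphi(M;\bar b)|-\mu|M|\big|<C|M|^{1/2}$ for some $\mu\in E$; and for each $\mu\in E$ there is an $\mathcal{L}$-formula $\varphi_\mu(\bar y)$ defining, uniformly in $M\in\mathcal{C}$, the set of $\bar b$ with $\big||\varphi(M;\bar b)|-\mu|M|\big|<C|M|^{1/2}$. The theory of an infinite ultraproduct of members of such a class is supersimple of SU-rank one, hence geometric (acl satisfies exchange, $\exists^\infty$ eliminated). For a geometric theory $T$ in $\mathcal{L}$ and $H$ a new unary predicate, an $\mathcal{L}\cup\{H\}$-structure $(M,H(M))$ is an $H$-expansion of $M$ if: (1) $M\models T$; (2) $H(M)$ is an $\mathrm{acl}_{\mathcal{L}}$-independent subset of $M$; (3) (density) for every finite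 dimensional $A\subseteq M$ (i.e. $A\subseteq\mathrm{acl}_{\mathcal{L}}(a_1,\dots,a_n)$ for some $a_j\in M$) and every non-algebraic $q\in S_1(A)$ there is $a\in H(M)$ realizing $q$; (4) (extension) for every such $A$ and $q$ there is $a\in M$ realizing $q$ with $a\notin\mathrm{acl}_{\mathcal{L}}(A\cup H(M))$. Here $T=\mathrm{Th}_{\mathcal{L}}(\mathcal{M})$. *)

theory Defs
  imports Complex_Main "HOL-Library.Countable_Set"
begin

section \<open>First-order syntax and semantics\<close>

record ('f, 'r) lang =
  funs :: "'f set"
  rels :: "'r set"
  fun_arity :: "'f \<Rightarrow> nat"
  rel_arity :: "'r \<Rightarrow> nat"

definition countable_lang :: "('f, 'r) lang \<Rightarrow> bool" where
  "countable_lang L \<longleftrightarrow> countable (funs L) \<and> countable (rels L)"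

datatype 'f tm = Var nat | Fn 'f "'f tm list"

datatype ('f, 'r) fm =
    Eq "'f tm" "'f tm"
  | Rel 'r "'f tm list"
  | Neg "('f, 'r) fm"
  | And "('f, 'r) fm" "('f, 'r) fm"
  | Ex nat "('f, 'r) fm"

fun wf_tm :: "('f, 'r) lang \<Rightarrow> 'f tm \<Rightarrow> bool" where
  "wf_tm L (Var n) \<longleftrightarrow> True"
| "wf_tm L (Fn f ts) \<longleftrightarrow> f \<in> funs L \<and> length ts = fun_arity L f \<and> (\<forall>t\<in>set ts. wf_tm L t)"

fun wf_fm :: "('f, 'r) lang \<Rightarrow> ('f, 'r) fm \<Rightarrow> bool" where
  "wf_fm L (Eq s t) \<longleftrightarrow> wf_tm L s \<and> wf_tm L t"
| "wf_fm L (Rel r ts) \<longleftrightarrow> r \<in> rels L \<and> length ts = rel_arity L r \<and> (\<forall>t\<in>set ts. wf_tm L t)"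
| "wf_fm L (Neg p) \<longleftrightarrow> wf_fm L p"
| "wf_fm L (And p q) \<longleftrightarrow> wf_fm L p \<and> wf_fm L q"
| "wf_fm L (Ex n p) \<longleftrightarrow> wf_fm L p"

fun tm_vars :: "'f tm \<Rightarrow> nat set" where
  "tm_vars (Var n) = {n}"
| "tm_vars (Fn f ts) = (\<Union>t\<in>set ts. tm_vars t)"

fun free_vars :: "('f, 'r) fm \<Rightarrow> nat set" where
  "free_vars (Eq s t) = tm_vars s \<union> tm_vars t"
| "free_vars (Rel r ts) = (\<Union>t\<in>set ts. tm_vars t)"
| "free_vars (Neg p) = free_vars p"
| "free_vars (And p q) = free_vars p \<union> free_vars q"
| "free_vars (Ex n p) = free_vars p - {n}"

record ('a, 'f, 'r) struct =
  univ :: "'a set"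
  fun_int :: "'f \<Rightarrow> 'a list \<Rightarrow> 'a"
  rel_int :: "'r \<Rightarrow> 'a list \<Rightarrow> bool"

definition is_struct :: "('f, 'r) lang \<Rightarrow> ('a, 'f, 'r) struct \<Rightarrow> bool" where
  "is_struct L A \<longleftrightarrow> univ A \<noteq> {} \<and>
     (\<forall>f\<in>funs L. \<forall>xs\<in>lists (univ A). length xs = fun_arity L f \<longrightarrow> fun_int A f xs \<in> univ A)"

fun eval :: "('a, 'f, 'r) struct \<Rightarrow> (nat \<Rightarrow> 'a) \<Rightarrow> 'f tm \<Rightarrow> 'a" where
  "eval A v (Var n) = v n"
| "eval A v (Fn f ts) = fun_int A f (map (eval A v) ts)"

fun sat :: "('a, 'f, 'r) struct \<Rightarrow> (nat \<Rightarrow> 'a) \<Rightarrow> ('f, 'r) fm \<Rightarrow> bool" where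
  "sat A v (Eq s t) \<longleftrightarrow> eval A v s = eval A v t"
| "sat A v (Rel r ts) \<longleftrightarrow> rel_int A r (map (eval A v) ts)"
| "sat A v (Neg p) \<longleftrightarrow> \<not> sat A v p"
| "sat A v (And p q) \<longleftrightarrow> sat A v p \<and> sat A v q"
| "sat A v (Ex n p) \<longleftrightarrow> (\<exists>a\<in>univ A. sat A (v(n := a)) p)"

definition sentence :: "('f, 'r) lang \<Rightarrow> ('f, 'r) fm \<Rightarrow> bool" where
  "sentence L p \<longleftrightarrow> wf_fm L p \<and> free_vars p = {}"

definition models :: "('a, 'f, 'r) struct \<Rightarrow> ('f, 'r) fm set \<Rightarrow> bool" where
  "models A T \<longleftrightarrow> (\<forall>p\<in>T. \<forall>v. sat A v p)"

definition Th :: "('f, 'r) lang \<Rightarrow> ('a, 'f, 'r) struct \<Rightarrow> ('f, 'r) fm set" where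
  "Th L A = {p. sentence L p \<and> (\<forall>v. sat A v p)}"

text \<open>
  In a formula written $\varphi(x; y_1, \dots, y_m)$ the object variable \<open>x\<close> is variable \<open>0\<close>
  and \<open>y\<^sub>j\<close> is variable \<open>j\<close>. The assignment \<open>params bs\<close> sends \<open>y\<^sub>j\<close> to the \<open>j\<close>-th entry of \<open>bs\<close>;
  its values at \<open>0\<close> and beyond the length of \<open>bs\<close> are irrelevant.
\<close>

definition params :: "'a list \<Rightarrow> nat \<Rightarrow> 'a" where
  "params bs n = (case n of 0 \<Rightarrow> undefined | Suc j \<Rightarrow> bs ! j)"

definition formula_xy :: "('f, 'r) lang \<Rightarrow> nat \<Rightarrow> ('f, 'r) fm \<Rightarrow> bool" where
  "formula_xy L m p \<longleftrightarrow> wf_fm L p \<and> free_vars p \<subseteq> {0..m}"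

definition formula_y :: "('f, 'r) lang \<Rightarrow> nat \<Rightarrow> ('f, 'r) fm \<Rightarrow> bool" where
  "formula_y L m p \<longleftrightarrow> wf_fm L p \<and> free_vars p \<subseteq> {1..m}"

definition solutions :: "('a, 'f, 'r) struct \<Rightarrow> ('f, 'r) fm \<Rightarrow> 'a list \<Rightarrow> 'a set" where
  "solutions A p bs = {a \<in> univ A. sat A ((params bs)(0 := a)) p}"


section \<open>One-dimensional asymptotic classes\<close>

definition near_size :: "real \<Rightarrow> real \<Rightarrow> ('a, 'f, 'r) struct \<Rightarrow> ('f, 'r) fm \<Rightarrow> 'a list \<Rightarrow> bool" where
  "near_size C \<mu> M p bs \<longleftrightarrow>
     \<bar>real (card (solutions M p bs)) - \<mu> * real (card (univ M))\<bar> < C * sqrt (real (card (univ M)))"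

definition asymptotic_class_1 :: "('f, 'r) lang \<Rightarrow> ('a, 'f, 'r) struct set \<Rightarrow> bool" where
  "asymptotic_class_1 L K \<longleftrightarrow>
     (\<forall>M\<in>K. is_struct L M \<and> finite (univ M)) \<and>
     (\<forall>m p. formula_xy L m p \<longrightarrow>
        (\<exists>C>0. \<exists>E. finite E \<and> (\<forall>\<mu>\<in>E. \<mu> > 0) \<and>
           (\<forall>M\<in>K. \<forall>bs\<in>lists (univ M). length bs = m \<longrightarrow>
              real (card (solutions M p bs)) < C \<or> (\<exists>\<mu>\<in>E. near_size C \<mu> M p bs)) \<and>
           (\<forall>\<mu>\<in>E. \<exists>p\<^sub>\<mu>. formula_y L m p\<^sub>\<mu> \<and>
              (\<forall>M\<in>K. \<forall>bs\<in>lists (univ M). length bs = m \<longrightarrow>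
                 (sat M (params bs) p\<^sub>\<mu> \<longleftrightarrow> near_size C \<mu> M p bs)))))"


section \<open>Ultraproducts\<close>

definition ultrafilter :: "'i filter \<Rightarrow> bool" where
  "ultrafilter U \<longleftrightarrow> U \<noteq> bot \<and> (\<forall>P. eventually P U \<or> eventually (\<lambda>i. \<not> P i) U)"

definition up_rel ::
    "'i filter \<Rightarrow> ('i \<Rightarrow> ('a, 'f, 'r) struct) \<Rightarrow> (('i \<Rightarrow> 'a) \<times> ('i \<Rightarrow> 'a)) set" where
  "up_rel U M = {(f, g). (\<forall>i. f i \<in> univ (M i)) \<and> (\<forall>i. g i \<in> univ (M i)) \<and>
                         eventually (\<lambda>i. f i = g i) U}"

definition rep :: "'b set \<Rightarrow> 'b" where
  "rep c = (SOME f. f \<in> c)"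

definition ultraproduct ::
    "'i filter \<Rightarrow> ('i \<Rightarrow> ('a, 'f, 'r) struct) \<Rightarrow> (('i \<Rightarrow> 'a) set, 'f, 'r) struct" where
  "ultraproduct U M =
     \<lparr>univ = {f. \<forall>i. f i \<in> univ (M i)} // up_rel U M,
      fun_int = (\<lambda>F cs. up_rel U M `` {\<lambda>i. fun_int (M i) F (map (\<lambda>c. rep c i) cs)}),
      rel_int = (\<lambda>R cs. eventually (\<lambda>i. rel_int (M i) R (map (\<lambda>c. rep c i) cs)) U)\<rparr>"


section \<open>Algebraic closure and 1-types\<close>

definition acl :: "('f, 'r) lang \<Rightarrow> ('a, 'f, 'r) struct \<Rightarrow> 'a set \<Rightarrow> 'a set" where
  "acl L M A = {a. \<exists>p bs. bs \<in> lists A \<and> formula_xy L (length bs) p \<and>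
                          finite (solutions M p bs) \<and> a \<in> solutions M p bs}"

definition acl_independent :: "('f, 'r) lang \<Rightarrow> ('a, 'f, 'r) struct \<Rightarrow> 'a set \<Rightarrow> bool" where
  "acl_independent L M X \<longleftrightarrow> (\<forall>x\<in>X. x \<notin> acl L M (X - {x}))"

definition finite_dimensional :: "('f, 'r) lang \<Rightarrow> ('a, 'f, 'r) struct \<Rightarrow> 'a set \<Rightarrow> bool" where
  "finite_dimensional L M A \<longleftrightarrow> A \<subseteq> univ M \<and> (\<exists>as\<in>lists (univ M). A \<subseteq> acl L M (set as))"

text \<open>
  A formula over \<open>A\<close> in the single variable \<open>x\<close> is a pair of an \<open>L\<close>-formula $\varphi(x; \bar y)$
  and a tuple of parameters from \<open>A\<close>. A complete 1-type over \<open>A\<close> is a set of such formulas that is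
  consistent with the elementary diagram of \<open>M\<close> (equivalently, finitely satisfiable in \<open>M\<close>) and
  decides every formula over \<open>A\<close>.
\<close>

definition formulas_over ::
    "('f, 'r) lang \<Rightarrow> 'a set \<Rightarrow> (('f, 'r) fm \<times> 'a list) set" where
  "formulas_over L A = {(p, bs). bs \<in> lists A \<and> formula_xy L (length bs) p}"

definition realizes ::
    "('a, 'f, 'r) struct \<Rightarrow> 'a \<Rightarrow> (('f, 'r) fm \<times> 'a list) set \<Rightarrow> bool" where
  "realizes M a q \<longleftrightarrow> (\<forall>(p, bs)\<in>q. a \<in> solutions M p bs)"

definition types1 ::
    "('f, 'r) lang \<Rightarrow> ('a, 'f, 'r) struct \<Rightarrow> 'a set \<Rightarrow> (('f, 'r) fm \<times> 'a list) set set" where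
  "types1 L M A = {q. q \<subseteq> formulas_over L A \<and>
     (\<forall>F. finite F \<and> F \<subseteq> q \<longrightarrow> (\<exists>a\<in>univ M. realizes M a F)) \<and>
     (\<forall>(p, bs)\<in>formulas_over L A. (p, bs) \<in> q \<or> (Neg p, bs) \<in> q)}"

definition non_algebraic ::
    "('a, 'f, 'r) struct \<Rightarrow> (('f, 'r) fm \<times> 'a list) set \<Rightarrow> bool" where
  "non_algebraic M q \<longleftrightarrow> (\<forall>(p, bs)\<in>q. infinite (solutions M p bs))"


section \<open>H-expansions\<close>

text \<open>The relation symbols of \<open>L \<union> {H}\<close> are \<open>Some r\<close>, for \<open>r\<close> a relation symbol of \<open>L\<close>, and
  \<open>None\<close>, which is the new unary predicate \<open>H\<close>.\<close>

definition lang_H :: "('f, 'r) lang \<Rightarrow> ('f, 'r option) lang" where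
  "lang_H L = \<lparr>funs = funs L, rels = insert None (Some ` rels L), fun_arity = fun_arity L,
               rel_arity = (\<lambda>r. case r of None \<Rightarrow> 1 | Some r' \<Rightarrow> rel_arity L r')\<rparr>"

definition expand :: "('a, 'f, 'r) struct \<Rightarrow> 'a set \<Rightarrow> ('a, 'f, 'r option) struct" where
  "expand M X = \<lparr>univ = univ M, fun_int = fun_int M,
     rel_int = (\<lambda>r xs. case r of None \<Rightarrow> (\<exists>x\<in>X. xs = [x]) | Some r' \<Rightarrow> rel_int M r' xs)\<rparr>"

definition reduct :: "('a, 'f, 'r option) struct \<Rightarrow> ('a, 'f, 'r) struct" where
  "reduct N = \<lparr>univ = univ N, fun_int = fun_int N, rel_int = (\<lambda>r. rel_int N (Some r))\<rparr>"

definition H_part :: "('a, 'f, 'r option) struct \<Rightarrow> 'a set" where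
  "H_part N = {a \<in> univ N. rel_int N None [a]}"

definition H_structure ::
    "('f, 'r) lang \<Rightarrow> ('f, 'r) fm set \<Rightarrow> ('a, 'f, 'r option) struct \<Rightarrow> bool" where
  "H_structure L T N \<longleftrightarrow> (let M = reduct N; H = H_part N in
     is_struct (lang_H L) N \<and>
     models M T \<and>
     acl_independent L M H \<and>
     (\<forall>A q. finite_dimensional L M A \<and> q \<in> types1 L M A \<and> non_algebraic M q \<longrightarrow>
        (\<exists>a\<in>H. realizes M a q)) \<and>
     (\<forall>A q. finite_dimensional L M A \<and> q \<in> types1 L M A \<and> non_algebraic M q \<longrightarrow>
        (\<exists>a\<in>univ M. realizes M a q \<and> a \<notin> acl L M (A \<union> H))))"

definition H_expansion_of ::
    "('f, 'r) lang \<Rightarrow> ('a, 'f, 'r) struct \<Rightarrow> ('a, 'f, 'r option) struct \<Rightarrow> bool" where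
  "H_expansion_of L M N \<longleftrightarrow> reduct N = M \<and> H_structure L (Th L M) N"

end

theory Submission
  imports Defs "HOL-Real_Asymp.Real_Asymp"
begin

text \<open>
  In a structure with \<open>n\<close> elements every definable set is either bounded or a positive proportion of
  the universe. Hence one can choose elements greedily, each outside the bounded sets definable over
  the previous ones and each meeting a fixed proportion of the large definable sets not met so far.
  As there are only polynomially many large sets, about \<open>(ln n)\<^sup>2\<close> choices meet all of them, and so
  few elements have an algebraic closure of size \<open>o(n)\<close>. In the ultraproduct the large sets become the
  infinite ones, so that density and extension follow from countable saturation. The greedy choice
  only keeps each element out of the algebraic closure of the earlier ones; independence then needs
  the exchange property, which comes from double counting: if all fibres over \<open>y\<close> of a relation
  \<open>R x y\<close> are bounded, then only boundedly many \<open>x\<close> have a fibre of positive proportion.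
\<close>

section \<open>Syntax\<close>

text \<open>What counts as bounded, and how large a factor must be for the estimates to hold,
  depends on the formula, so no single factor is expected to serve all formulas at once. The greedy
  choice handles finitely many formulas in every sufficiently large factor; the saturation argument
  that later realizes types, applied with lists as points, merges these choices into one list per
  index. The definability clause of asymptotic classes enters through exchange: double counting
  bounds the set of x with a large fibre in each factor, but this yields algebraicity in the
  ultraproduct only because that set is the solution set of a formula.\<close>

instance tm :: (countable) countable
  by countable_datatype

instance fm :: (countable, countable) countable
  by countable_datatype

lemma set_tm_wf: "wf_tm L t \<Longrightarrow> set_tm t \<subseteq> funs L"
  by (induction t) auto

lemma set_fm_wf: "wf_fm L p \<Longrightarrow> set1_fm p \<subseteq> funs L \<and> set2_fm p \<subseteq> rels L"
  by (induction p) (use set_tm_wf in fastforce)+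

text \<open>The types of symbols may be uncountable; only the symbols of \<open>L\<close> are
  countable. Coding these as natural numbers is injective on the formulas they form and lands in a
  countable type.\<close>

lemma countable_wf_fm:
  assumes "countable_lang L"
  shows "countable {p. wf_fm L p}"
proof -
  obtain f :: "'a \<Rightarrow> nat" and g :: "'b \<Rightarrow> nat" where fg: "inj_on f (funs L)" "inj_on g (rels L)"
    using assms unfolding countable_lang_def countable_def by blast
  have "inj_on (map_fm f g) {p. wf_fm L p}"
  proof (rule inj_onI)
    fix p q assume "p \<in> {p. wf_fm L p}" "q \<in> {p. wf_fm L p}" and eq: "map_fm f g p = map_fm f g q"
    then have "set1_fm p \<subseteq> funs L" "set1_fm q \<subseteq> funs L" "set2_fm p \<subseteq> rels L" "set2_fm q \<subseteq> rels L"
      using set_fm_wf by (metis mem_Collect_eq)+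
    then show "p = q"
      using fg by (intro fm.inj_map_strong[OF _ _ eq]) (auto dest: inj_onD)
  qed
  then show ?thesis
    by (rule countableI')
qed

lemma countable_formulas_over:
  assumes "countable_lang L" and "countable A"
  shows "countable (formulas_over L A)"
  by (rule countable_subset[of _ "{p. wf_fm L p} \<times> lists A"])
     (auto simp: formulas_over_def formula_xy_def intro!: countable_SIGMA countable_wf_fm assms)

lemma finite_tm_vars: "finite (tm_vars t)"
  by (induction t) auto

lemma finite_free_vars: "finite (free_vars p)"
  by (induction p) (auto simp: finite_tm_vars)

lemma eval_cong: "(\<And>n. n \<in> tm_vars t \<Longrightarrow> v n = w n) \<Longrightarrow> eval A v t = eval A w t"
proof (induction t)
  case (Fn f ts)
  then have "map (eval A v) ts = map (eval A w) ts" by auto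
  then show ?case by (simp only: eval.simps)
qed auto

lemma sat_cong: "(\<And>n. n \<in> free_vars p \<Longrightarrow> v n = w n) \<Longrightarrow> sat A v p = sat A w p"
proof (induction p arbitrary: v w)
  case (Eq s t)
  then show ?case using eval_cong[of s v w A] eval_cong[of t v w A] by auto
next
  case (Rel r ts)
  then have "map (eval A v) ts = map (eval A w) ts" by (auto intro!: eval_cong)
  then show ?case by (simp only: sat.simps)
next
  case (Ex n p)
  have "sat A (v(n := a)) p = sat A (w(n := a)) p" for a
    by (rule Ex.IH) (use Ex.prems in auto)
  then show ?case by simp
next
  case (Neg p)
  then show ?case by (metis free_vars.simps(3) sat.simps(3))
next
  case (And p q)
  then show ?case by (metis UnCI free_vars.simps(4) sat.simps(4))
qed

section \<open>Renaming variables and changing parameter tuples\<close>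

fun rename_tm :: "(nat \<Rightarrow> nat) \<Rightarrow> 'f tm \<Rightarrow> 'f tm" where
  "rename_tm \<sigma> (Var n) = Var (\<sigma> n)"
| "rename_tm \<sigma> (Fn f ts) = Fn f (map (rename_tm \<sigma>) ts)"

text \<open>\<open>\<sigma>\<close> need not be injective: bound variables are replaced by fresh ones to avoid capture.\<close>

fun rename :: "(nat \<Rightarrow> nat) \<Rightarrow> ('f, 'r) fm \<Rightarrow> ('f, 'r) fm" where
  "rename \<sigma> (Eq s t) = Eq (rename_tm \<sigma> s) (rename_tm \<sigma> t)"
| "rename \<sigma> (Rel r ts) = Rel r (map (rename_tm \<sigma>) ts)"
| "rename \<sigma> (Neg p) = Neg (rename \<sigma> p)"
| "rename \<sigma> (And p q) = And (rename \<sigma> p) (rename \<sigma> q)"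
| "rename \<sigma> (Ex n p) =
     (let k = SOME k. k \<notin> \<sigma> ` free_vars p in Ex k (rename (\<sigma>(n := k)) p))"

lemma fresh_var:
  fixes \<sigma> :: "nat \<Rightarrow> nat"
  shows "(SOME k. k \<notin> \<sigma> ` free_vars p) \<notin> \<sigma> ` free_vars p"
  by (rule someI_ex, rule ex_new_if_finite) (simp_all add: finite_free_vars)

lemma wf_rename_tm [simp]: "wf_tm L (rename_tm \<sigma> t) = wf_tm L t"
  by (induction t) auto

lemma wf_rename [simp]: "wf_fm L (rename \<sigma> p) = wf_fm L p"
  by (induction p arbitrary: \<sigma>) (auto simp: Let_def)

lemma tm_vars_rename_tm [simp]: "tm_vars (rename_tm \<sigma> t) = \<sigma> ` tm_vars t"
  by (induction t) auto

lemma free_vars_rename: "free_vars (rename \<sigma> p) \<subseteq> \<sigma> ` free_vars p"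
proof (induction p arbitrary: \<sigma>)
  case (Ex n p)
  define k where "k = (SOME k. k \<notin> \<sigma> ` free_vars p)"
  have "free_vars (rename (\<sigma>(n := k)) p) \<subseteq> insert k (\<sigma> ` (free_vars p - {n}))"
    using Ex.IH[of "\<sigma>(n := k)"] by fastforce
  then show ?case by (auto simp: k_def[symmetric] Let_def)
qed fastforce+

lemma eval_rename_tm [simp]: "eval A v (rename_tm \<sigma> t) = eval A (\<lambda>m. v (\<sigma> m)) t"
proof (induction t)
  case (Fn f ts)
  then have "map (eval A v) (map (rename_tm \<sigma>) ts) = map (eval A (\<lambda>m. v (\<sigma> m))) ts" by auto
  then show ?case by (simp only: eval.simps rename_tm.simps)
qed auto

lemma sat_rename: "sat A v (rename \<sigma> p) = sat A (\<lambda>m. v (\<sigma> m)) p"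
proof (induction p arbitrary: v \<sigma>)
  case (Ex n p)
  define k where "k = (SOME k. k \<notin> \<sigma> ` free_vars p)"
  have "k \<notin> \<sigma> ` free_vars p" unfolding k_def by (rule fresh_var)
  then have "sat A (\<lambda>m. (v(k := a)) ((\<sigma>(n := k)) m)) p = sat A ((\<lambda>m. v (\<sigma> m))(n := a)) p" for a
    by (intro sat_cong) auto
  then show ?case by (simp add: Ex.IH k_def[symmetric] Let_def)
next
  case (Rel r ts)
  have "map (eval A v) (map (rename_tm \<sigma>) ts) = map (eval A (\<lambda>m. v (\<sigma> m))) ts" by auto
  then show ?case by (simp only: sat.simps rename.simps)
qed auto

text \<open>\<open>\<sigma>\<close> acts on list positions, counted from 0, while the parameter at
  position j is variable \<open>Suc j\<close>; hence the two shifts.\<close>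

definition reindex :: "(nat \<Rightarrow> nat) \<Rightarrow> ('f, 'r) fm \<Rightarrow> ('f, 'r) fm" where
  "reindex \<sigma> = rename (\<lambda>n. case n of 0 \<Rightarrow> 0 | Suc j \<Rightarrow> Suc (\<sigma> j))"

lemma formula_xy_reindex:
  assumes "formula_xy L m p" and "\<And>j. j < m \<Longrightarrow> \<sigma> j < k"
  shows "formula_xy L k (reindex \<sigma> p)"
proof -
  have "(\<lambda>n. case n of 0 \<Rightarrow> 0 | Suc j \<Rightarrow> Suc (\<sigma> j)) ` {0..m} \<subseteq> {0..k}"
    using assms(2) by (auto split: nat.splits simp: Suc_le_eq)
  moreover have "free_vars p \<subseteq> {0..m}" using assms(1) by (simp add: formula_xy_def)
  ultimately show ?thesis
    using assms(1) free_vars_rename[of _ p] unfolding formula_xy_def reindex_def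
    by (metis (no_types, lifting) image_mono order_trans wf_rename)
qed

lemma solutions_reindex:
  assumes "formula_xy L (length bs) p" and "\<And>j. j < length bs \<Longrightarrow> bs ! j = cs ! \<sigma> j"
  shows "solutions M (reindex \<sigma> p) cs = solutions M p bs"
proof -
  have "sat M (\<lambda>m. ((params cs)(0 := a)) (case m of 0 \<Rightarrow> 0 | Suc j \<Rightarrow> Suc (\<sigma> j))) p
      = sat M ((params bs)(0 := a)) p" for a
    using assms unfolding formula_xy_def
    by (intro sat_cong) (force simp: params_def split: nat.splits)
  then show ?thesis
    by (simp add: solutions_def reindex_def sat_rename)
qed

lemma obtain_reindexing:
  assumes "set bs \<subseteq> set cs"
  obtains \<sigma> where "\<And>j. j < length bs \<Longrightarrow> \<sigma> j < length cs \<and> bs ! j = cs ! \<sigma> j"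
proof -
  have "\<forall>j. \<exists>k. j < length bs \<longrightarrow> k < length cs \<and> bs ! j = cs ! k"
    using assms by (metis in_set_conv_nth subset_code(1) nth_mem)
  then show ?thesis using that by metis
qed

text \<open>A witness of algebraicity may list its parameters in any order, with repetitions or
  omissions. Reindexing moves it to the given enumeration, so later arguments may choose the
  tuple.\<close>

lemma acl_over_list:
  assumes "a \<in> acl L M (set cs)"
  obtains p where "formula_xy L (length cs) p" "finite (solutions M p cs)" "a \<in> solutions M p cs"
proof -
  obtain p bs where *: "bs \<in> lists (set cs)" "formula_xy L (length bs) p"
      "finite (solutions M p bs)" "a \<in> solutions M p bs"
    using assms unfolding acl_def by blast
  then have "set bs \<subseteq> set cs" by auto
  then obtain \<sigma> where \<sigma>: "\<And>j. j < length bs \<Longrightarrow> \<sigma> j < length cs \<and> bs ! j = cs ! \<sigma> j"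
    using obtain_reindexing by metis
  have "solutions M (reindex \<sigma> p) cs = solutions M p bs"
    by (rule solutions_reindex[OF *(2)]) (use \<sigma> in auto)
  moreover have "formula_xy L (length cs) (reindex \<sigma> p)"
    by (rule formula_xy_reindex[OF *(2)]) (use \<sigma> in auto)
  ultimately show ?thesis using that * by metis
qed

lemma acl_listI:
  "formula_xy L (length cs) p \<Longrightarrow> finite (solutions M p cs) \<Longrightarrow> a \<in> solutions M p cs \<Longrightarrow>
   a \<in> acl L M (set cs)"
  unfolding acl_def by auto

lemma countable_acl:
  assumes "countable_lang L" and "countable A"
  shows "countable (acl L M A)"
proof (rule countable_subset)
  let ?F = "{(p, bs) \<in> formulas_over L A. finite (solutions M p bs)}"
  show "acl L M A \<subseteq> (\<Union>(p, bs)\<in>?F. solutions M p bs)"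
    unfolding acl_def formulas_over_def by blast
  have "countable ?F"
    by (rule countable_subset[OF _ countable_formulas_over[OF assms]]) auto
  then show "countable (\<Union>(p, bs)\<in>?F. solutions M p bs)"
    by (rule countable_UN) (auto intro: countable_finite)
qed

text \<open>The parameters will live in the ultraproduct while the conjunction is used in the
  factors; \<open>g\<close> is then a coordinate map, and one conjunction serves all factors.
  Parameter lists are concatenated, which is why the second conjunct is shifted by
  \<open>length bs\<close>.\<close>

lemma formulas_over_conj:
  assumes "finite F" and "F \<subseteq> formulas_over L A"
  obtains p bs where "(p, bs) \<in> formulas_over L A"
    "\<And>(g :: 'a \<Rightarrow> 'b) M. solutions M p (map g bs) =
       {x \<in> univ M. \<forall>(p', bs')\<in>F. x \<in> solutions M p' (map g bs')}"
proof -
  have "\<exists>(p, bs)\<in>formulas_over L A. \<forall>(g :: 'a \<Rightarrow> 'b) M. solutions M p (map g bs) =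
       {x \<in> univ M. \<forall>(p', bs')\<in>F. x \<in> solutions M p' (map g bs')}"
    using assms
  proof (induction F rule: finite_induct)
    case empty
    show ?case
      by (rule bexI[of _ "(Eq (Var 0) (Var 0), [])"])
         (auto simp: solutions_def formulas_over_def formula_xy_def)
  next
    case (insert x F)
    obtain p' bs' where x: "x = (p', bs')" by (cases x)
    then have p': "formula_xy L (length bs') p'" "bs' \<in> lists A"
      using insert.prems by (auto simp: formulas_over_def)
    obtain p bs where p: "bs \<in> lists A" "formula_xy L (length bs) p" and
      IH: "\<And>(g :: 'a \<Rightarrow> 'b) M. solutions M p (map g bs) =
       {x \<in> univ M. \<forall>(p', bs')\<in>F. x \<in> solutions M p' (map g bs')}"
      using insert.IH insert.prems by (auto simp: formulas_over_def)
    let ?cs = "bs @ bs'"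
    let ?p = "reindex (\<lambda>j. j) p" and ?p' = "reindex (\<lambda>j. length bs + j) p'"
    have "formula_xy L (length ?cs) ?p" "formula_xy L (length ?cs) ?p'"
      using p p' formula_xy_reindex[of L "length bs" p] formula_xy_reindex[of L "length bs'" p']
      by auto
    then have "(And ?p ?p', ?cs) \<in> formulas_over L A"
      using p p' by (auto simp: formulas_over_def formula_xy_def)
    moreover have "solutions M (And ?p ?p') (map g ?cs) =
       {y \<in> univ M. \<forall>(p', bs')\<in>insert x F. y \<in> solutions M p' (map g bs')}"
      for g :: "'a \<Rightarrow> 'b" and M
    proof -
      have "solutions M ?p (map g ?cs) = solutions M p (map g bs)"
        using p by (intro solutions_reindex[where L = L]) (auto simp: nth_append)
      moreover have "solutions M ?p' (map g ?cs) = solutions M p' (map g bs')"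
        using p' by (intro solutions_reindex[where L = L]) (auto simp: nth_append)
      moreover have "solutions M (And ?p ?p') (map g ?cs) =
          solutions M ?p (map g ?cs) \<inter> solutions M ?p' (map g ?cs)"
        by (auto simp: solutions_def)
      ultimately show ?thesis
        by (auto simp: IH x)
    qed
    ultimately show ?case by blast
  qed
  then show ?thesis using that by blast
qed

section \<open>Sizes of definable sets in an asymptotic class\<close>

lemma near_size_disjunction:
  assumes "finite E" and K: "\<And>M. M \<in> K \<Longrightarrow> is_struct L M"
    and "\<And>\<mu>. \<mu> \<in> E \<Longrightarrow> \<exists>p\<^sub>\<mu>. formula_y L m p\<^sub>\<mu> \<and> (\<forall>M\<in>K. \<forall>bs\<in>lists (univ M). length bs = m \<longrightarrow>
           (sat M (params bs) p\<^sub>\<mu> \<longleftrightarrow> near_size C \<mu> M p bs))"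
  shows "\<exists>q. formula_y L m q \<and> (\<forall>M\<in>K. \<forall>bs\<in>lists (univ M). length bs = m \<longrightarrow>
           (sat M (params bs) q \<longleftrightarrow> (\<exists>\<mu>\<in>E. near_size C \<mu> M p bs)))"
  using assms(1,3)
proof (induction E rule: finite_induct)
  case empty
  \<comment> \<open>Falsity has to be a sentence, since for \<open>m = 0\<close> no variable is
    available; refuting it uses that universes are nonempty.\<close>
  have "formula_y L m (Neg (Ex 0 (Eq (Var 0) (Var 0))))" by (simp add: formula_y_def)
  moreover have "sat M v (Ex 0 (Eq (Var 0) (Var 0)))" if "M \<in> K" for M v
    using K[OF that] by (auto simp: is_struct_def)
  ultimately show ?case by (metis empty_iff sat.simps(3))
next
  case (insert \<mu> E)
  obtain p1 where p1: "formula_y L m p1" "\<forall>M\<in>K. \<forall>bs\<in>lists (univ M). length bs = m \<longrightarrow>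
           (sat M (params bs) p1 \<longleftrightarrow> near_size C \<mu> M p bs)"
    using insert.prems by blast
  obtain p2 where p2: "formula_y L m p2" "\<forall>M\<in>K. \<forall>bs\<in>lists (univ M). length bs = m \<longrightarrow>
           (sat M (params bs) p2 \<longleftrightarrow> (\<exists>\<mu>\<in>E. near_size C \<mu> M p bs))"
    using insert.IH insert.prems by blast
  have "formula_y L m (Neg (And (Neg p1) (Neg p2)))"
    using p1 p2 by (auto simp: formula_y_def)
  moreover have "sat M v (Neg (And (Neg p1) (Neg p2))) \<longleftrightarrow> sat M v p1 \<or> sat M v p2" for M v
    by simp
  ultimately show ?case
    using p1(2) p2(2) by (metis insert_iff)
qed

text \<open>The lower bound \<open>C\<close> in the large case makes the alternatives exclusive, so
  that in members with at least \<open>n0\<close> elements \<open>q\<close> defines exactly the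
  parameters with at least \<open>C\<close> solutions. Restricting to such members is the price for
  one gap in place of the estimates around each measure.\<close>

definition dichotomy ::
    "('f, 'r) lang \<Rightarrow> ('a, 'f, 'r) struct set \<Rightarrow> nat \<Rightarrow> ('f, 'r) fm \<Rightarrow>
     nat \<Rightarrow> nat \<Rightarrow> real \<Rightarrow> ('f, 'r) fm \<Rightarrow> bool" where
  "dichotomy L K m p C n0 \<delta> q \<longleftrightarrow> \<delta> > 0 \<and> formula_y L m q \<and>
     (\<forall>M\<in>K. \<forall>bs\<in>lists (univ M). n0 \<le> card (univ M) \<longrightarrow> length bs = m \<longrightarrow>
       (if sat M (params bs) q
        then C \<le> card (solutions M p bs) \<and> \<delta> * card (univ M) \<le> card (solutions M p bs)
        else card (solutions M p bs) < C))"

text \<open>The measures in \<open>E\<close> are at least \<open>2 * \<delta>\<close>, and in a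
  large structure the error \<open>C * sqrt n\<close> is at most \<open>\<delta> * n\<close>, so a
  set near any of the measures keeps the proportion \<open>\<delta>\<close>.\<close>

lemma uniform_dichotomy:
  fixes L :: "('f, 'r) lang" and K :: "('a, 'f, 'r) struct set"
  assumes "asymptotic_class_1 L K" and "formula_xy L m p"
  shows "\<exists>C n0 \<delta> q. dichotomy L K m p C n0 \<delta> q"
proof -
  obtain C E where C: "C > 0" and E: "finite E" "\<forall>\<mu>\<in>E. \<mu> > 0"
    and dich: "\<forall>M\<in>K. \<forall>bs\<in>lists (univ M). length bs = m \<longrightarrow>
              real (card (solutions M p bs)) < C \<or> (\<exists>\<mu>\<in>E. near_size C \<mu> M p bs)"
    and def_E: "\<forall>\<mu>\<in>E. \<exists>p\<^sub>\<mu>. formula_y L m p\<^sub>\<mu> \<and>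
              (\<forall>M\<in>K. \<forall>bs\<in>lists (univ M). length bs = m \<longrightarrow>
                 (sat M (params bs) p\<^sub>\<mu> \<longleftrightarrow> near_size C \<mu> M p bs))"
    using conjunct2[OF assms(1)[unfolded asymptotic_class_1_def], THEN spec, THEN spec, THEN mp, OF assms(2)]
    by (elim exE conjE) (rule that, assumption+)
  have "\<And>M. M \<in> K \<Longrightarrow> is_struct L M"
    using assms(1) unfolding asymptotic_class_1_def by blast
  then obtain q where q: "formula_y L m q" "\<forall>M\<in>K. \<forall>bs\<in>lists (univ M). length bs = m \<longrightarrow>
           (sat M (params bs) q \<longleftrightarrow> (\<exists>\<mu>\<in>E. near_size C \<mu> M p bs))"
    using near_size_disjunction[OF E(1), of K L m C p] def_E by blast
  \<comment> \<open>Half the least measure; the inserted 1 covers empty \<open>E\<close>.\<close>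
  define \<delta> where "\<delta> = Min (insert 1 E) / 2"
  have \<delta>: "\<delta> > 0" "\<And>\<mu>. \<mu> \<in> E \<Longrightarrow> 2 * \<delta> \<le> \<mu>"
    using E unfolding \<delta>_def by auto
  define C' where "C' = nat \<lceil>C\<rceil>"
  \<comment> \<open>The first bound gives \<open>C * sqrt n \<le> \<delta> * n\<close>, the second
    \<open>C' \<le> \<delta> * n\<close>.\<close>
  define n0 where "n0 = nat \<lceil>max ((C / \<delta>)\<^sup>2) (C' / \<delta>)\<rceil>"
  have "if sat M (params bs) q
       then C' \<le> card (solutions M p bs) \<and> \<delta> * card (univ M) \<le> card (solutions M p bs)
       else card (solutions M p bs) < C'"
    if M: "M \<in> K" "n0 \<le> card (univ M)" "bs \<in> lists (univ M)" "length bs = m" for M bs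
  proof (cases "sat M (params bs) q")
    case True
    let ?n = "real (card (univ M))"
    have n: "(C / \<delta>)\<^sup>2 \<le> ?n" "C' / \<delta> \<le> ?n"
      using M(2) unfolding n0_def by linarith+
    obtain \<mu> where \<mu>: "\<mu> \<in> E" "near_size C \<mu> M p bs" using q M True by blast
    have "C / \<delta> \<le> sqrt ?n" using n(1) real_le_rsqrt by blast
    then have "C \<le> \<delta> * sqrt ?n" using \<delta>(1) by (simp add: field_simps)
    then have "C * sqrt ?n \<le> \<delta> * sqrt ?n * sqrt ?n" by (intro mult_right_mono) auto
    then have "C * sqrt ?n \<le> \<delta> * ?n" by (simp only: mult.assoc real_sqrt_mult_self abs_of_nat)
    moreover have "2 * \<delta> * ?n \<le> \<mu> * ?n" using \<delta>(2)[OF \<mu>(1)] by (intro mult_right_mono) auto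
    moreover have "\<mu> * ?n - C * sqrt ?n \<le> card (solutions M p bs)"
      using \<mu>(2) unfolding near_size_def by linarith
    ultimately have "\<delta> * ?n \<le> card (solutions M p bs)" by linarith
    moreover have "real C' \<le> \<delta> * ?n" using n(2) \<delta>(1) by (simp add: field_simps)
    ultimately show ?thesis using True by auto
  next
    case False
    then have "real (card (solutions M p bs)) < C" using q M dich by blast
    then have "card (solutions M p bs) < C'" unfolding C'_def by linarith
    then show ?thesis using False by simp
  qed
  then have "dichotomy L K m p C' n0 \<delta> q" using \<delta>(1) q(1) unfolding dichotomy_def by blast
  then show ?thesis by blast
qed

section \<open>Counting\<close>

lemma double_count:
  "finite X \<Longrightarrow> finite Y \<Longrightarrow> (\<Sum>x\<in>X. card {y \<in> Y. R x y}) = (\<Sum>y\<in>Y. card {x \<in> X. R x y})"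
  by (simp only: card_eq_sum) (rule sum.swap_restrict)

text \<open>Count the pairs in \<open>X\<close> times \<open>V\<close> satisfying \<open>R\<close>:
  at least \<open>card X * \<delta> * card V\<close> summed along x, at most
  \<open>C * card V\<close> summed along y. Cancelling \<open>card V\<close> needs \<open>V\<close>
  nonempty.\<close>

lemma card_large_fibres:
  fixes \<delta> :: real
  assumes "finite V" "V \<noteq> {}" and "\<And>y. y \<in> V \<Longrightarrow> card {x \<in> V. R x y} \<le> C"
    and "\<And>x. x \<in> X \<Longrightarrow> x \<in> V \<and> \<delta> * card V \<le> card {y \<in> V. R x y}"
  shows "\<delta> * card X \<le> C"
proof -
  have X: "X \<subseteq> V" "finite X" using assms(1,4) finite_subset[of X V] by auto
  have "card X * (\<delta> * card V) = (\<Sum>x\<in>X. \<delta> * card V)" by simp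
  also have "\<dots> \<le> (\<Sum>x\<in>X. real (card {y \<in> V. R x y}))"
    by (rule sum_mono) (use assms(4) in auto)
  also have "\<dots> = real (\<Sum>x\<in>X. card {y \<in> V. R x y})" by simp
  also have "\<dots> = real (\<Sum>y\<in>V. card {x \<in> X. R x y})" using double_count[OF X(2) assms(1)] by metis
  also have "\<dots> \<le> real (\<Sum>y\<in>V. C)"
  proof (intro of_nat_mono sum_mono)
    fix y assume y: "y \<in> V"
    have "card {x \<in> X. R x y} \<le> card {x \<in> V. R x y}"
      using X assms(1) by (intro card_mono) auto
    then show "card {x \<in> X. R x y} \<le> C" using assms(3)[OF y] by simp
  qed
  also have "\<dots> = card V * C" by simp
  finally have "card V * (\<delta> * card X) \<le> card V * real C" by (simp add: mult_ac)
  then show ?thesis using assms(1,2) by (simp add: card_gt_0_iff)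
qed

section \<open>Greedy choice of a hitting list\<close>

text \<open>Lists grow at the head, so the tail of a list consists of the earlier choices.\<close>

fun avoids :: "('a set \<Rightarrow> 'a set) \<Rightarrow> 'a list \<Rightarrow> bool" where
  "avoids B [] \<longleftrightarrow> True"
| "avoids B (x # xs) \<longleftrightarrow> x \<notin> B (set xs) \<and> avoids B xs"

lemma avoids_mono: "avoids B xs \<Longrightarrow> (\<And>X. B' X \<subseteq> B X) \<Longrightarrow> avoids B' xs"
  by (induction xs) auto

lemma avoids_append: "avoids B (xs @ ys) \<Longrightarrow> avoids B ys"
  by (induction xs) auto

text \<open>A large set loses at most half of its guaranteed size to the forbidden set, so some
  allowed point lies in a proportion \<open>\<delta> / 2\<close> of the sets still unmet; each
  choice thus multiplies their number by at most \<open>1 - \<delta> / 2\<close>. \<open>T\<close>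
  limits the sets over which the forbidden set is known to be small.\<close>

lemma greedy_hitting_list:
  fixes \<delta> :: real
  assumes V: "finite V" "V \<noteq> {}" and F: "finite F" "\<And>s. s \<in> F \<Longrightarrow> s \<subseteq> V \<and> \<delta> * card V \<le> card s"
    and \<delta>: "0 < \<delta>" "\<delta> \<le> 1"
    and B: "\<And>X. X \<subseteq> V \<Longrightarrow> card X \<le> T \<Longrightarrow> finite (B X) \<and> card (B X) \<le> \<delta> / 2 * card V"
  shows "t \<le> T \<Longrightarrow> \<exists>hs. set hs \<subseteq> V \<and> length hs \<le> t \<and> avoids B hs \<and>
    card {s \<in> F. s \<inter> set hs = {}} \<le> (1 - \<delta> / 2) ^ t * card F"
proof (induction t)
  case 0
  show ?case by (rule exI[of _ "[]"]) simp
next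
  case (Suc t)
  then obtain hs where hs: "set hs \<subseteq> V" "length hs \<le> t" "avoids B hs"
    "card {s \<in> F. s \<inter> set hs = {}} \<le> (1 - \<delta> / 2) ^ t * card F" by auto
  define F' where "F' = {s \<in> F. s \<inter> set hs = {}}"
  have F': "finite F'" "F' \<subseteq> F" using F(1) by (auto simp: F'_def)
  show ?case
  proof (cases "F' = {}")
    \<comment> \<open>All sets are met already and the list is not extended; this is why only
      \<open>length hs \<le> t\<close> is claimed.\<close>
    case True
    then have "{s \<in> F. s \<inter> set hs = {}} = {}" by (simp add: F'_def)
    then have "card {s \<in> F. s \<inter> set hs = {}} \<le> (1 - \<delta> / 2) ^ Suc t * card F"
      using \<delta> by (simp only: card.empty) simp
    then show ?thesis using hs by (intro exI[of _ hs]) auto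
  next
    case False
    let ?n = "real (card V)" and ?W = "V - B (set hs)"
    have n: "?n > 0" using V by (simp add: card_gt_0_iff)
    have B': "finite (B (set hs))" "card (B (set hs)) \<le> \<delta> / 2 * ?n"
      using B[of "set hs"] hs Suc.prems card_length[of hs] by auto
    have large: "\<delta> / 2 * ?n \<le> card {x \<in> ?W. x \<in> s}" if "s \<in> F'" for s
    proof -
      have s: "s \<subseteq> V" "\<delta> * ?n \<le> card s" using F(2) F' that by auto
      have "{x \<in> ?W. x \<in> s} = s - B (set hs)" using s by auto
      moreover have "card s - card (B (set hs)) \<le> card (s - B (set hs))"
        using B'(1) by (rule diff_card_le_card_Diff)
      ultimately have "real (card s) \<le> card (B (set hs)) + card {x \<in> ?W. x \<in> s}" by simp
      then show ?thesis using s(2) B'(2) by linarith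
    qed
    \<comment> \<open>Averaging over the allowed points: otherwise counting incidences by points
      would give less than \<open>card F' * (\<delta> / 2 * card V)\<close>, the lower bound from
      counting by sets.\<close>
    have "\<exists>x\<in>?W. \<delta> / 2 * card F' \<le> card {s \<in> F'. x \<in> s}"
    proof (rule ccontr)
      assume neg: "\<not> ?thesis"
      obtain s where "s \<in> F'" using False by blast
      then have "real (card {x \<in> ?W. x \<in> s}) > 0"
        using large[of s] mult_pos_pos[of "\<delta> / 2" ?n] n \<delta>(1) by linarith
      then have W: "?W \<noteq> {}" "finite ?W" using V by (auto simp: card_gt_0_iff)
      have "card F' * (\<delta> / 2 * ?n) = (\<Sum>s\<in>F'. \<delta> / 2 * ?n)" by simp
      also have "\<dots> \<le> (\<Sum>s\<in>F'. real (card {x \<in> ?W. x \<in> s}))"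
        by (rule sum_mono) (use large in auto)
      also have "\<dots> = real (\<Sum>s\<in>F'. card {x \<in> ?W. x \<in> s})" by simp
      also have "\<dots> = real (\<Sum>x\<in>?W. card {s \<in> F'. x \<in> s})"
        using double_count[OF F'(1) W(2), of "\<lambda>s x. x \<in> s"] by metis
      also have "\<dots> = (\<Sum>x\<in>?W. real (card {s \<in> F'. x \<in> s}))" by simp
      also have "\<dots> < (\<Sum>x\<in>?W. \<delta> / 2 * card F')"
      proof (rule sum_strict_mono[OF W(2,1)])
        fix x assume "x \<in> ?W"
        then show "real (card {s \<in> F'. x \<in> s}) < \<delta> / 2 * card F'" using neg by force
      qed
      also have "\<dots> = card ?W * (\<delta> / 2 * card F')" by simp
      also have "\<dots> \<le> ?n * (\<delta> / 2 * card F')"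
        using V \<delta> by (intro mult_right_mono) (auto intro!: card_mono)
      finally show False by (simp add: mult_ac)
    qed
    then obtain x where x: "x \<in> ?W" "\<delta> / 2 * card F' \<le> card {s \<in> F'. x \<in> s}" by blast
    have "{s \<in> F. s \<inter> set (x # hs) = {}} = F' - {s \<in> F'. x \<in> s}" by (auto simp: F'_def)
    then have "card {s \<in> F. s \<inter> set (x # hs) = {}} = card F' - card {s \<in> F'. x \<in> s}"
      using F'(1) by (simp add: card_Diff_subset)
    moreover have "card {s \<in> F'. x \<in> s} \<le> card F'" using F'(1) by (intro card_mono) auto
    ultimately have "card {s \<in> F. s \<inter> set (x # hs) = {}} \<le> (1 - \<delta> / 2) * card F'"
      using x(2) by (simp add: of_nat_diff algebra_simps)
    also have "\<dots> \<le> (1 - \<delta> / 2) * ((1 - \<delta> / 2) ^ t * card F)"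
      using hs(4) \<delta> unfolding F'_def by (intro mult_left_mono) auto
    finally have "card {s \<in> F. s \<inter> set (x # hs) = {}} \<le> (1 - \<delta> / 2) ^ Suc t * card F"
      by (simp only: power_Suc mult.assoc)
    moreover have "set (x # hs) \<subseteq> V" "length (x # hs) \<le> Suc t" "avoids B (x # hs)"
      using x(1) hs by auto
    ultimately show ?thesis by blast
  qed
qed

section \<open>The number of choices\<close>

text \<open>Any function growing faster than \<open>ln n\<close>, all of whose powers are \<open>o(n)\<close>, would do.\<close>

definition budget :: "nat \<Rightarrow> nat" where
  "budget n = nat \<lfloor>(ln (real n))\<^sup>2\<rfloor>"

text \<open>This keeps closures small: through a formula with \<open>k\<close> parameters,
  \<open>budget n\<close> elements give at most \<open>budget n ^ k\<close> bounded sets, which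
  cover a vanishing proportion of \<open>n\<close> points.\<close>

lemma budget_power_sublinear: "(\<lambda>n. real (budget n) ^ k / real n) \<longlonglongrightarrow> 0"
proof (rule tendsto_sandwich[OF _ _ tendsto_const])
  show "\<forall>\<^sub>F n in sequentially. 0 \<le> real (budget n) ^ k / real n" by simp
  have "real (budget n) \<le> (ln (real n))\<^sup>2" for n unfolding budget_def by simp
  then show "\<forall>\<^sub>F n in sequentially. real (budget n) ^ k / real n \<le> ((ln (real n))\<^sup>2) ^ k / real n"
    by (intro always_eventually allI divide_right_mono power_mono) auto
  show "(\<lambda>n. ((ln (real n))\<^sup>2) ^ k / real n) \<longlonglongrightarrow> 0" by real_asymp
qed

text \<open>Here \<open>n ^ m\<close> bounds the number of parameter tuples and
  \<open>r ^ budget n\<close> the fraction of sets still unmet. In the exponent the square of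
  \<open>ln n\<close> beats the multiple \<open>m * ln n\<close>.\<close>

lemma budget_decay:
  assumes "0 < r" "r < 1"
  shows "(\<lambda>n. r ^ budget n * real n ^ m) \<longlonglongrightarrow> 0"
proof (rule tendsto_sandwich[OF _ _ tendsto_const])
  show "\<forall>\<^sub>F n in sequentially. 0 \<le> r ^ budget n * real n ^ m" using assms by simp
  define c where "c = - ln r"
  have c: "c > 0" using assms by (simp add: c_def)
  \<comment> \<open>The \<open>- 1\<close> absorbs the rounding in \<open>budget\<close>.\<close>
  have "r ^ budget n \<le> exp (- c * ((ln (real n))\<^sup>2 - 1))" for n
  proof -
    have "r ^ budget n = exp (- c * budget n)"
      using assms by (simp add: c_def mult.commute[of "ln r"] exp_of_nat_mult)
    moreover have "(ln (real n))\<^sup>2 - 1 \<le> budget n"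
      unfolding budget_def by linarith
    ultimately show ?thesis using c by simp
  qed
  then show "\<forall>\<^sub>F n in sequentially.
      r ^ budget n * real n ^ m \<le> exp (- c * ((ln (real n))\<^sup>2 - 1)) * real n ^ m"
    by (intro always_eventually allI mult_right_mono) auto
  have "filterlim (\<lambda>n. c * ((ln (real n))\<^sup>2 - 1) - m * ln (real n)) at_top sequentially"
    using c by real_asymp
  then have "(\<lambda>n. exp (- (c * ((ln (real n))\<^sup>2 - 1) - m * ln (real n)))) \<longlonglongrightarrow> 0"
    by (intro filterlim_compose[OF exp_at_bot]) (simp add: filterlim_uminus_at_top)
  moreover have "\<forall>\<^sub>F n in sequentially. exp (- (c * ((ln (real n))\<^sup>2 - 1) - m * ln (real n))) =
      exp (- c * ((ln (real n))\<^sup>2 - 1)) * real n ^ m"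
    using eventually_gt_at_top[of 0]
  proof eventually_elim
    case (elim n)
    have "exp (- (c * ((ln (real n))\<^sup>2 - 1) - m * ln (real n))) =
        exp (- c * ((ln (real n))\<^sup>2 - 1)) * exp (m * ln (real n))"
      by (simp add: exp_add[symmetric])
    then show ?case using elim by (simp add: exp_of_nat_mult)
  qed
  ultimately show "(\<lambda>n. exp (- c * ((ln (real n))\<^sup>2 - 1)) * real n ^ m) \<longlonglongrightarrow> 0"
    by (rule Lim_transform_eventually)
qed

text \<open>The trace of algebraic closure in a finite structure: \<open>S\<close> will be the
  solution set of one formula as a function of its parameters, and its values of size below
  \<open>C\<close> play the algebraic sets.\<close>

definition small_union :: "nat \<Rightarrow> nat \<Rightarrow> ('a list \<Rightarrow> 'a set) \<Rightarrow> 'a set \<Rightarrow> 'a set" where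
  "small_union m C S X = (\<Union>bs\<in>{bs \<in> lists X. length bs = m \<and> card (S bs) < C}. S bs)"

lemma finite_lists_length: "finite X \<Longrightarrow> finite {bs \<in> lists X. length bs = m}"
  using finite_lists_length_eq[of X m] by (simp add: lists_eq_set)

lemma card_lists_length: "finite X \<Longrightarrow> card {bs \<in> lists X. length bs = m} = card X ^ m"
  using card_lists_length_eq[of X m] by (simp add: lists_eq_set)

lemma card_small_union:
  assumes "finite X"
  shows "card (small_union m C S X) \<le> card X ^ m * C"
proof -
  let ?I = "{bs \<in> lists X. length bs = m \<and> card (S bs) < C}"
  have fin: "finite ?I" by (rule finite_subset[OF _ finite_lists_length[OF assms, of m]]) auto
  then have "card (small_union m C S X) \<le> (\<Sum>bs\<in>?I. card (S bs))"
    unfolding small_union_def by (rule card_UN_le)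
  also have "\<dots> \<le> (\<Sum>bs\<in>?I. C)" by (rule sum_mono) auto
  also have "\<dots> = card ?I * C" by simp
  also have "\<dots> \<le> card {bs \<in> lists X. length bs = m} * C"
    by (intro mult_right_mono card_mono finite_lists_length assms) auto
  finally show ?thesis by (simp add: card_lists_length assms)
qed

text \<open>The greedy choice for finitely many formulas \<open>j\<close>, with \<open>n1\<close>
  depending on the numerical data but on neither \<open>V\<close> nor \<open>S\<close>. The
  forbidden set is the union of the small unions of all \<open>j\<close>. Its size is controlled by
  \<open>budget_power_sublinear\<close>; \<open>budget_decay\<close> brings the number of unmet sets
  below 1, hence to 0.\<close>

lemma independent_hitting_list:
  fixes \<delta> :: "'j \<Rightarrow> real" and C m :: "'j \<Rightarrow> nat"
  assumes J: "finite J" and \<delta>: "\<And>j. j \<in> J \<Longrightarrow> \<delta> j > 0"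
  obtains n1 :: nat where
    "\<And>(V :: 'a set) S. finite V \<Longrightarrow> n1 \<le> card V \<Longrightarrow> (\<And>j bs. j \<in> J \<Longrightarrow> S j bs \<subseteq> V) \<Longrightarrow>
      (\<And>j bs. j \<in> J \<Longrightarrow> bs \<in> lists V \<Longrightarrow> length bs = m j \<Longrightarrow>
         card (S j bs) < C j \<or> \<delta> j * card V \<le> card (S j bs)) \<Longrightarrow>
      \<exists>hs. set hs \<subseteq> V \<and> length hs \<le> budget (card V) \<and>
        (\<forall>j\<in>J. (\<forall>bs\<in>lists V. length bs = m j \<and> C j \<le> card (S j bs) \<longrightarrow> S j bs \<inter> set hs \<noteq> {}) \<and>
               avoids (small_union (m j) (C j) (S j)) hs)"
proof -
  \<comment> \<open>One proportion for all \<open>j\<close>; the inserted 1 covers empty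
    \<open>J\<close> and gives \<open>\<delta>0 \<le> 1\<close>, as the greedy lemma
    requires.\<close>
  define \<delta>0 where "\<delta>0 = Min (insert 1 (\<delta> ` J))"
  have \<delta>0: "0 < \<delta>0" "\<delta>0 \<le> 1" "\<And>j. j \<in> J \<Longrightarrow> \<delta>0 \<le> \<delta> j"
    using J \<delta> unfolding \<delta>0_def by auto
  have "(\<lambda>n. \<Sum>j\<in>J. C j * (real (budget n) ^ m j / real n)) \<longlonglongrightarrow> (\<Sum>j\<in>J. real (C j) * 0)"
    by (intro tendsto_intros budget_power_sublinear)
  then have "\<forall>\<^sub>F n in sequentially. (\<Sum>j\<in>J. C j * (real (budget n) ^ m j / real n)) < \<delta>0 / 2"
    using \<delta>0 by (intro order_tendstoD(2)) auto
  moreover have "(\<lambda>n. \<Sum>j\<in>J. (1 - \<delta>0 / 2) ^ budget n * real n ^ m j) \<longlonglongrightarrow> (\<Sum>j\<in>J. 0)"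
    using \<delta>0 by (intro tendsto_intros budget_decay) auto
  then have "\<forall>\<^sub>F n in sequentially. (\<Sum>j\<in>J. (1 - \<delta>0 / 2) ^ budget n * real n ^ m j) < 1"
    by (intro order_tendstoD(2)) auto
  ultimately have "\<forall>\<^sub>F n in sequentially.
      (\<Sum>j\<in>J. C j * (real (budget n) ^ m j / real n)) < \<delta>0 / 2 \<and>
      (\<Sum>j\<in>J. (1 - \<delta>0 / 2) ^ budget n * real n ^ m j) < 1 \<and> n > 0"
    using eventually_gt_at_top by (intro eventually_conj)
  then obtain n1 where n1: "\<And>n. n1 \<le> n \<Longrightarrow>
      (\<Sum>j\<in>J. C j * (real (budget n) ^ m j / real n)) < \<delta>0 / 2 \<and>
      (\<Sum>j\<in>J. (1 - \<delta>0 / 2) ^ budget n * real n ^ m j) < 1 \<and> n > 0"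
    unfolding eventually_sequentially by blast
  show ?thesis
  proof (rule that[of n1])
    fix V :: "'a set" and S
    assume V: "finite V" "n1 \<le> card V" and sub: "\<And>j bs. j \<in> J \<Longrightarrow> S j bs \<subseteq> V"
      and dich: "\<And>j bs. j \<in> J \<Longrightarrow> bs \<in> lists V \<Longrightarrow> length bs = m j \<Longrightarrow>
         card (S j bs) < C j \<or> \<delta> j * card V \<le> card (S j bs)"
    let ?n = "card V"
    have n: "?n > 0" using V n1 by blast
    define B where "B X = (\<Union>j\<in>J. small_union (m j) (C j) (S j) X)" for X
    define I where "I j = {bs \<in> lists V. length bs = m j \<and> C j \<le> card (S j bs)}" for j
    define F where "F = (\<Union>j\<in>J. S j ` I j)"
    have I: "finite (I j)" "card (I j) \<le> ?n ^ m j" for j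
    proof -
      have *: "I j \<subseteq> {bs \<in> lists V. length bs = m j}" by (auto simp: I_def)
      show "finite (I j)"
        using finite_subset[OF * finite_lists_length[OF V(1)]] .
      show "card (I j) \<le> ?n ^ m j"
        using card_mono[OF finite_lists_length[OF V(1)] *] card_lists_length[OF V(1), of "m j"] by simp
    qed
    have F: "finite F" unfolding F_def using J I by auto
    have "card F \<le> (\<Sum>j\<in>J. card (S j ` I j))"
      unfolding F_def using J by (rule card_UN_le)
    also have "\<dots> \<le> (\<Sum>j\<in>J. ?n ^ m j)"
      by (intro sum_mono) (use I card_image_le le_trans in blast)
    finally have "real (card F) \<le> real (\<Sum>j\<in>J. ?n ^ m j)" by (rule of_nat_mono)
    then have cardF: "real (card F) \<le> (\<Sum>j\<in>J. real ?n ^ m j)" by simp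
    have Fs: "s \<subseteq> V \<and> \<delta>0 * ?n \<le> card s" if sF: "s \<in> F" for s
    proof -
      obtain j bs where j: "j \<in> J" "bs \<in> lists V" "length bs = m j" "C j \<le> card (S j bs)" "s = S j bs"
        using sF unfolding F_def I_def by blast
      then have "\<delta> j * ?n \<le> card s" using dich[of j bs] by auto
      moreover have "\<delta>0 * ?n \<le> \<delta> j * ?n" using \<delta>0(3)[OF j(1)] by (intro mult_right_mono) auto
      ultimately show ?thesis using j sub by auto
    qed
    have B: "finite (B X) \<and> card (B X) \<le> \<delta>0 / 2 * ?n" if X: "X \<subseteq> V" "card X \<le> budget ?n" for X
    proof
      have finX: "finite X" using X V finite_subset by blast
      have "B X \<subseteq> V" unfolding B_def small_union_def using sub by blast
      then show "finite (B X)" using V finite_subset by blast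
      have "card (B X) \<le> (\<Sum>j\<in>J. card (small_union (m j) (C j) (S j) X))"
        unfolding B_def using J by (rule card_UN_le)
      also have "\<dots> \<le> (\<Sum>j\<in>J. budget ?n ^ m j * C j)"
      proof (rule sum_mono)
        fix j
        have "card X ^ m j * C j \<le> budget ?n ^ m j * C j"
          using X by (intro mult_right_mono power_mono) auto
        then show "card (small_union (m j) (C j) (S j) X) \<le> budget ?n ^ m j * C j"
          using card_small_union[OF finX, of "m j" "C j" "S j"] by linarith
      qed
      finally have "real (card (B X)) \<le> real (\<Sum>j\<in>J. budget ?n ^ m j * C j)" by (rule of_nat_mono)
      then have "real (card (B X)) \<le> (\<Sum>j\<in>J. real (budget ?n) ^ m j * C j)" by simp
      also have "\<dots> = (\<Sum>j\<in>J. C j * (real (budget ?n) ^ m j / ?n)) * ?n"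
        unfolding sum_distrib_right using n by (intro sum.cong) auto
      also have "\<dots> \<le> \<delta>0 / 2 * ?n"
        using n1[OF V(2)] by (intro mult_right_mono) auto
      finally show "card (B X) \<le> \<delta>0 / 2 * ?n" .
    qed
    have "V \<noteq> {}" using n by auto
    then obtain hs where hs: "set hs \<subseteq> V" "length hs \<le> budget ?n" "avoids B hs"
        "card {s \<in> F. s \<inter> set hs = {}} \<le> (1 - \<delta>0 / 2) ^ budget ?n * card F"
      using greedy_hitting_list[where B = B and T = "budget ?n", OF V(1) _ F Fs \<delta>0(1,2) B order_refl]
      by blast
    have "(1 - \<delta>0 / 2) ^ budget ?n * card F \<le> (1 - \<delta>0 / 2) ^ budget ?n * (\<Sum>j\<in>J. real ?n ^ m j)"
      using cardF \<delta>0 by (intro mult_left_mono) auto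
    also have "\<dots> < 1" using n1[OF V(2)] by (simp add: sum_distrib_left)
    finally have "card {s \<in> F. s \<inter> set hs = {}} = 0" using hs(4) by linarith
    then have "{s \<in> F. s \<inter> set hs = {}} = {}" using F by simp
    then have "\<forall>j\<in>J. \<forall>bs\<in>lists V. length bs = m j \<and> C j \<le> card (S j bs) \<longrightarrow> S j bs \<inter> set hs \<noteq> {}"
      unfolding F_def I_def by blast
    moreover have "avoids (small_union (m j) (C j) (S j)) hs" if "j \<in> J" for j
      using hs(3) by (rule avoids_mono) (use that in \<open>auto simp: B_def\<close>)
    ultimately show "\<exists>hs. set hs \<subseteq> V \<and> length hs \<le> budget (card V) \<and>
        (\<forall>j\<in>J. (\<forall>bs\<in>lists V. length bs = m j \<and> C j \<le> card (S j bs) \<longrightarrow> S j bs \<inter> set hs \<noteq> {}) \<and>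
               avoids (small_union (m j) (C j) (S j)) hs)"
      using hs(1,2) by blast
  qed
qed

section \<open>Ultraproducts\<close>

lemma ultrafilter_not_eventually:
  assumes "ultrafilter U"
  shows "eventually (\<lambda>i. \<not> P i) U \<longleftrightarrow> \<not> eventually P U"
proof
  assume *: "eventually (\<lambda>i. \<not> P i) U"
  show "\<not> eventually P U"
  proof
    assume "eventually P U"
    with * have "eventually (\<lambda>_. False) U" by eventually_elim simp
    then show False using assms by (simp add: ultrafilter_def eventually_False)
  qed
qed (use assms in \<open>auto simp: ultrafilter_def\<close>)

lemma ultrafilter_eventually_bex:
  assumes "ultrafilter U" "finite S" "eventually (\<lambda>i. \<exists>c\<in>S. Q c i) U"
  shows "\<exists>c\<in>S. eventually (Q c) U"
proof (rule ccontr)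
  assume "\<not> ?thesis"
  then have "\<forall>c\<in>S. eventually (\<lambda>i. \<not> Q c i) U"
    using ultrafilter_not_eventually[OF assms(1)] by blast
  then have "eventually (\<lambda>i. \<forall>c\<in>S. \<not> Q c i) U" using assms(2) by (simp add: eventually_ball_finite)
  then have "eventually (\<lambda>i. \<not> (\<exists>c\<in>S. Q c i)) U" by simp
  then show False using assms(3) ultrafilter_not_eventually[OF assms(1)] by blast
qed

lemma eval_in_univ:
  "is_struct L A \<Longrightarrow> wf_tm L t \<Longrightarrow> (\<And>n. n \<in> tm_vars t \<Longrightarrow> v n \<in> univ A) \<Longrightarrow> eval A v t \<in> univ A"
proof (induction t)
  case (Fn f ts)
  then have "map (eval A v) ts \<in> lists (univ A)" by fastforce
  then show ?case using Fn.prems(1,2) by (simp add: is_struct_def)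
qed simp

section \<open>Classes, coordinates and the theorem of Los\<close>

locale struct_family =
  fixes L :: "('f, 'r) lang" and U :: "'i filter" and M :: "'i \<Rightarrow> ('a, 'f, 'r) struct"
  assumes ultra: "ultrafilter U" and struct_M: "\<And>i. is_struct L (M i)"
begin

abbreviation N :: "(('i \<Rightarrow> 'a) set, 'f, 'r) struct" where
  "N \<equiv> ultraproduct U M"

definition cls :: "('i \<Rightarrow> 'a) \<Rightarrow> ('i \<Rightarrow> 'a) set" where
  "cls f = up_rel U M `` {f}"

abbreviation coord :: "'i \<Rightarrow> ('i \<Rightarrow> 'a) set \<Rightarrow> 'a" where
  "coord i c \<equiv> rep c i"

lemma univ_N: "univ N = cls ` {f. \<forall>i. f i \<in> univ (M i)}"
  by (auto simp: ultraproduct_def quotient_def cls_def)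

lemma equiv_up_rel: "equiv {f. \<forall>i. f i \<in> univ (M i)} (up_rel U M)"
proof (rule equivI)
  show "sym (up_rel U M)" by (rule symI) (auto simp: up_rel_def elim: eventually_mono)
  show "trans (up_rel U M)" by (rule transI) (auto simp: up_rel_def elim: eventually_elim2)
qed (auto simp: refl_on_def up_rel_def)

lemma cls_eqI:
  assumes "\<And>i. f i \<in> univ (M i)" "\<And>i. g i \<in> univ (M i)" "eventually (\<lambda>i. f i = g i) U"
  shows "cls f = cls g"
  unfolding cls_def by (rule equiv_class_eq[OF equiv_up_rel]) (use assms in \<open>auto simp: up_rel_def\<close>)

text \<open>Coordinates are read off a chosen representative, which lies in the universe at every
  index but agrees with \<open>f\<close> only almost everywhere.\<close>

lemma rep_cls:
  assumes "\<And>i. f i \<in> univ (M i)"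
  shows "coord i (cls f) \<in> univ (M i)" and "eventually (\<lambda>i. coord i (cls f) = f i) U"
proof -
  have "f \<in> cls f" using assms by (auto simp: cls_def up_rel_def)
  then have "rep (cls f) \<in> cls f" unfolding rep_def by (rule someI[of "\<lambda>g. g \<in> cls f"])
  then have *: "(f, rep (cls f)) \<in> up_rel U M" by (simp add: cls_def)
  then show "coord i (cls f) \<in> univ (M i)" by (auto simp: up_rel_def)
  from * have "eventually (\<lambda>i. f i = coord i (cls f)) U" by (auto simp: up_rel_def)
  then show "eventually (\<lambda>i. coord i (cls f) = f i) U" by eventually_elim simp
qed

lemma cls_in_univ: "(\<And>i. f i \<in> univ (M i)) \<Longrightarrow> cls f \<in> univ N"
  by (auto simp: univ_N)

lemma coord_in_univ: "c \<in> univ N \<Longrightarrow> coord i c \<in> univ (M i)"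
  using rep_cls(1) by (auto simp: univ_N)

lemma cls_rep: "c \<in> univ N \<Longrightarrow> cls (rep c) = c"
proof -
  assume "c \<in> univ N"
  then obtain f where f: "c = cls f" "\<And>i. f i \<in> univ (M i)" by (auto simp: univ_N)
  have "cls (rep (cls f)) = cls f"
    by (rule cls_eqI) (use rep_cls[of f] f(2) in blast)+
  then show ?thesis using f(1) by simp
qed

lemma map_coord_in_lists: "bs \<in> lists (univ N) \<Longrightarrow> map (coord i) bs \<in> lists (univ (M i))"
  using coord_in_univ by auto

lemma eq_iff_coord:
  assumes "a \<in> univ N" "b \<in> univ N"
  shows "a = b \<longleftrightarrow> eventually (\<lambda>i. coord i a = coord i b) U"
proof
  assume "eventually (\<lambda>i. coord i a = coord i b) U"
  then have "cls (rep a) = cls (rep b)" by (intro cls_eqI coord_in_univ assms)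
  then show "a = b" using assms by (simp add: cls_rep)
qed simp

lemma eventually_coord_inj:
  assumes "finite S" "S \<subseteq> univ N"
  shows "eventually (\<lambda>i. inj_on (coord i) S) U"
proof -
  have "eventually (\<lambda>i. coord i a = coord i b \<longrightarrow> a = b) U" if "a \<in> S" "b \<in> S" for a b
  proof (cases "a = b")
    case False
    then have "eventually (\<lambda>i. coord i a \<noteq> coord i b) U"
      using eq_iff_coord[of a b] that assms(2) ultrafilter_not_eventually[OF ultra] by blast
    then show ?thesis by eventually_elim simp
  qed simp
  then have "eventually (\<lambda>i. \<forall>a\<in>S. \<forall>b\<in>S. coord i a = coord i b \<longrightarrow> a = b) U"
    using assms(1) by (simp add: eventually_ball_finite)
  then show ?thesis by eventually_elim (auto simp: inj_on_def)
qed

lemma some_in_univ: "\<exists>f. \<forall>i. f i \<in> univ (M i)"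
proof -
  have "\<forall>i. \<exists>x. x \<in> univ (M i)" 
    using struct_M[unfolded is_struct_def] by (simp add: ex_in_conv)
  then show ?thesis by metis
qed

lemma fun_int_N:
  "fun_int N F cs = cls (\<lambda>i. fun_int (M i) F (map (coord i) cs))"
  by (simp add: ultraproduct_def cls_def)

lemma rel_int_N:
  "rel_int N R cs = eventually (\<lambda>i. rel_int (M i) R (map (coord i) cs)) U"
  by (simp add: ultraproduct_def)

lemma is_struct_N: "is_struct L N"
proof -
  have "univ N \<noteq> {}" using some_in_univ by (auto simp: univ_N)
  moreover have "fun_int N F cs \<in> univ N"
    if "F \<in> funs L" "cs \<in> lists (univ N)" "length cs = fun_arity L F" for F cs
    unfolding fun_int_N
    using that struct_M map_coord_in_lists[OF that(2)]
    by (intro cls_in_univ) (simp add: is_struct_def)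
  ultimately show ?thesis by (simp add: is_struct_def)
qed

lemma coord_eval:
  assumes "wf_tm L t" "\<And>n. n \<in> tm_vars t \<Longrightarrow> v n \<in> univ N"
  shows "eventually (\<lambda>i. coord i (eval N v t) = eval (M i) (\<lambda>n. coord i (v n)) t) U"
  using assms
proof (induction t)
  case (Fn F ts)
  let ?cs = "map (eval N v) ts"
  have cs: "?cs \<in> lists (univ N)" using Fn.prems by (fastforce intro: eval_in_univ[OF is_struct_N])
  have "eventually (\<lambda>i. \<forall>t\<in>set ts. coord i (eval N v t) = eval (M i) (\<lambda>n. coord i (v n)) t) U"
    by (intro eventually_ball_finite ballI Fn.IH) (use Fn.prems in auto)
  moreover have "eventually (\<lambda>i. coord i (eval N v (Fn F ts)) = fun_int (M i) F (map (coord i) ?cs)) U"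
    unfolding eval.simps fun_int_N
    by (rule rep_cls(2))
       (use struct_M map_coord_in_lists[OF cs] Fn.prems(1) in \<open>simp add: is_struct_def\<close>)
  ultimately show ?case
  proof eventually_elim
    case (elim i)
    then have "map (coord i) ?cs = map (eval (M i) (\<lambda>n. coord i (v n))) ts" by auto
    then show ?case using elim(2) by (simp only: eval.simps)
  qed
qed simp

text \<open>Values in the universe are demanded for free variables only, since \<open>params\<close>
  is unspecified at 0 and beyond the list.\<close>

theorem los:
  assumes "wf_fm L p" "\<And>n. n \<in> free_vars p \<Longrightarrow> v n \<in> univ N"
  shows "sat N v p \<longleftrightarrow> eventually (\<lambda>i. sat (M i) (\<lambda>n. coord i (v n)) p) U"
  using assms
proof (induction p arbitrary: v)
  case (Eq s t)
  have "eventually (\<lambda>i. coord i (eval N v s) = eval (M i) (\<lambda>n. coord i (v n)) s \<and>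
      coord i (eval N v t) = eval (M i) (\<lambda>n. coord i (v n)) t) U"
    by (intro eventually_conj coord_eval) (use Eq.prems in auto)
  then have "eventually (\<lambda>i. sat (M i) (\<lambda>n. coord i (v n)) (Eq s t) \<longleftrightarrow>
      coord i (eval N v s) = coord i (eval N v t)) U"
    by eventually_elim simp
  then have "eventually (\<lambda>i. sat (M i) (\<lambda>n. coord i (v n)) (Eq s t)) U \<longleftrightarrow>
      eventually (\<lambda>i. coord i (eval N v s) = coord i (eval N v t)) U"
    by (rule eventually_subst)
  moreover have "eval N v s \<in> univ N" "eval N v t \<in> univ N"
    using Eq.prems by (auto intro!: eval_in_univ[OF is_struct_N])
  ultimately show ?case using eq_iff_coord by simp
next
  case (Rel R ts)
  have "eventually (\<lambda>i. \<forall>t\<in>set ts. coord i (eval N v t) = eval (M i) (\<lambda>n. coord i (v n)) t) U"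
    by (intro eventually_ball_finite ballI coord_eval) (use Rel.prems in auto)
  then have "eventually (\<lambda>i. rel_int (M i) R (map (coord i) (map (eval N v) ts)) \<longleftrightarrow>
      sat (M i) (\<lambda>n. coord i (v n)) (Rel R ts)) U"
  proof eventually_elim
    case (elim i)
    then have "map (coord i) (map (eval N v) ts) = map (eval (M i) (\<lambda>n. coord i (v n))) ts" by auto
    then show ?case by (simp only: sat.simps)
  qed
  then show ?case unfolding sat.simps(2)[of N] rel_int_N by (rule eventually_subst)
next
  case (Neg p)
  then show ?case by (simp add: ultrafilter_not_eventually[OF ultra])
next
  case (And p q)
  then show ?case by (simp add: eventually_conj_iff)
next
  case (Ex n p)
  have IH: "sat N (v(n := a)) p \<longleftrightarrow>
      eventually (\<lambda>i. sat (M i) ((\<lambda>m. coord i (v m))(n := coord i a)) p) U" if "a \<in> univ N" for a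
  proof -
    have "(\<lambda>m. coord i ((v(n := a)) m)) = (\<lambda>m. coord i (v m))(n := coord i a)" for i by auto
    moreover have "sat N (v(n := a)) p \<longleftrightarrow>
        eventually (\<lambda>i. sat (M i) (\<lambda>m. coord i ((v(n := a)) m)) p) U"
      by (rule Ex.IH) (use Ex.prems that in auto)
    ultimately show ?thesis by (simp only:)
  qed
  show ?case
  proof
    assume "sat N v (Ex n p)"
    then obtain a where a: "a \<in> univ N" "sat N (v(n := a)) p" by auto
    then have "eventually (\<lambda>i. sat (M i) ((\<lambda>m. coord i (v m))(n := coord i a)) p) U" using IH by blast
    then show "eventually (\<lambda>i. sat (M i) (\<lambda>m. coord i (v m)) (Ex n p)) U"
      by eventually_elim (use coord_in_univ[OF a(1)] in auto)
  next
    assume ev: "eventually (\<lambda>i. sat (M i) (\<lambda>m. coord i (v m)) (Ex n p)) U"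
    \<comment> \<open>A class needs a value at every index, so where the existential formula fails
      an arbitrary element is taken.\<close>
    have "\<forall>i. \<exists>x. x \<in> univ (M i) \<and> (sat (M i) (\<lambda>m. coord i (v m)) (Ex n p) \<longrightarrow>
        sat (M i) ((\<lambda>m. coord i (v m))(n := x)) p)"
      using some_in_univ by auto
    then obtain f where f: "\<And>i. f i \<in> univ (M i)" "\<And>i. sat (M i) (\<lambda>m. coord i (v m)) (Ex n p) \<Longrightarrow>
        sat (M i) ((\<lambda>m. coord i (v m))(n := f i)) p"
      by metis
    have "eventually (\<lambda>i. sat (M i) ((\<lambda>m. coord i (v m))(n := coord i (cls f))) p) U"
      using ev rep_cls(2)[of f, OF f(1)] by eventually_elim (use f(2) in auto)
    then have "sat N (v(n := cls f)) p" using IH cls_in_univ[of f] f(1) by blast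
    then show "sat N v (Ex n p)" using cls_in_univ[of f] f(1) by auto
  qed
qed

lemma los_solutions:
  assumes p: "formula_xy L (length bs) p" and bs: "bs \<in> lists (univ N)" and a: "a \<in> univ N"
  shows "a \<in> solutions N p bs \<longleftrightarrow>
    eventually (\<lambda>i. coord i a \<in> solutions (M i) p (map (coord i) bs)) U"
proof -
  let ?v = "(params bs)(0 := a)"
  have v: "?v n \<in> univ N" if "n \<in> free_vars p" for n
    using that p bs a by (cases n) (auto simp: params_def formula_xy_def)
  have "sat (M i) (\<lambda>n. coord i (?v n)) p =
      sat (M i) ((params (map (coord i) bs))(0 := coord i a)) p" for i
    using p by (intro sat_cong) (auto simp: params_def formula_xy_def split: nat.splits)
  then show ?thesis
    using los[of p ?v] v p a coord_in_univ[OF a] by (simp add: solutions_def formula_xy_def)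
qed

end

section \<open>Finite factors and saturation\<close>

locale finite_struct_family = struct_family +
  assumes finite_M: "\<And>i. finite (univ (M i))"
begin

lemma finite_solutions_M: "finite (solutions (M i) p bs)"
  using finite_M by (simp add: solutions_def)

text \<open>Finitely many distinct elements have distinct coordinates almost everywhere; conversely,
  injections of \<open>{..k}\<close> into the solution sets of the factors assemble to
  \<open>Suc k\<close> distinct classes. Working with elements avoids formulas that express having
  at least k solutions.\<close>

lemma infinite_solutions_iff:
  assumes p: "formula_xy L (length bs) p" and bs: "bs \<in> lists (univ N)"
  shows "infinite (solutions N p bs) \<longleftrightarrow>
    (\<forall>k. eventually (\<lambda>i. k \<le> card (solutions (M i) p (map (coord i) bs))) U)"
proof
  assume inf: "infinite (solutions N p bs)"
  show "\<forall>k. eventually (\<lambda>i. k \<le> card (solutions (M i) p (map (coord i) bs))) U"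
  proof
    fix k
    obtain X where X: "X \<subseteq> solutions N p bs" "finite X" "card X = k"
      using infinite_arbitrarily_large[OF inf] by blast
    have sub: "X \<subseteq> univ N" using X by (auto simp: solutions_def)
    have "eventually (\<lambda>i. \<forall>x\<in>X. coord i x \<in> solutions (M i) p (map (coord i) bs)) U"
      using X sub los_solutions[OF p bs] by (intro eventually_ball_finite) auto
    moreover have "eventually (\<lambda>i. inj_on (coord i) X) U"
      using X sub by (intro eventually_coord_inj) auto
    ultimately show "eventually (\<lambda>i. k \<le> card (solutions (M i) p (map (coord i) bs))) U"
    proof eventually_elim
      case (elim i)
      have "card (coord i ` X) \<le> card (solutions (M i) p (map (coord i) bs))"
        using elim(1) by (intro card_mono finite_solutions_M) auto
      then show ?case using elim(2) X(3) by (simp add: card_image)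
    qed
  qed
next
  assume ev: "\<forall>k. eventually (\<lambda>i. k \<le> card (solutions (M i) p (map (coord i) bs))) U"
  show "infinite (solutions N p bs)"
  proof
    assume fin: "finite (solutions N p bs)"
    define k where "k = card (solutions N p bs)"
    let ?S = "\<lambda>i. solutions (M i) p (map (coord i) bs)"
    \<comment> \<open>\<open>g\<close> takes values in the universe even where there are too few
      solutions, so each \<open>j\<close> defines a class. \<open>{..k}\<close> has
      \<open>Suc k\<close> members, one more than the assumed number of solutions.\<close>
    have "\<exists>g. (\<forall>j. g j \<in> univ (M i)) \<and> (Suc k \<le> card (?S i) \<longrightarrow> inj_on g {..k} \<and> g ` {..k} \<subseteq> ?S i)" for i
    proof (cases "Suc k \<le> card (?S i)")
      case True
      then obtain g where g: "inj_on g {..k}" "g ` {..k} \<subseteq> ?S i"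
        using card_le_inj[of "{..k}" "?S i"] finite_solutions_M by auto
      moreover obtain u where "u \<in> univ (M i)" using some_in_univ by blast
      ultimately show ?thesis
        by (intro exI[of _ "\<lambda>j. if j \<le> k then g j else u"])
           (auto simp: solutions_def inj_on_def)
    qed (use some_in_univ in auto)
    then obtain f where f: "\<And>i j. f i j \<in> univ (M i)"
        "\<And>i. Suc k \<le> card (?S i) \<Longrightarrow> inj_on (f i) {..k} \<and> f i ` {..k} \<subseteq> ?S i"
      by metis
    define c where "c j = cls (\<lambda>i. f i j)" for j
    have c: "c j \<in> univ N" "eventually (\<lambda>i. coord i (c j) = f i j) U" for j
      unfolding c_def using cls_in_univ[of "\<lambda>i. f i j"] rep_cls(2)[of "\<lambda>i. f i j"] f(1) by auto
    have Suc: "eventually (\<lambda>i. Suc k \<le> card (?S i)) U" using ev by blast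
    have "c j \<in> solutions N p bs" if "j \<le> k" for j
    proof -
      have "eventually (\<lambda>i. coord i (c j) \<in> ?S i) U"
        using Suc c(2)[of j] by eventually_elim (use f(2) that in fastforce)
      then show ?thesis using los_solutions[OF p bs c(1)] by blast
    qed
    moreover have "inj_on c {..k}"
    proof (rule inj_onI)
      fix j l assume jl: "j \<in> {..k}" "l \<in> {..k}" "c j = c l"
      have "eventually (\<lambda>i. j = l) U"
        using Suc c(2)[of j] c(2)[of l] by eventually_elim (use f(2) jl in \<open>auto dest: inj_onD\<close>)
      then show "j = l" using ultra by (cases "j = l") (auto simp: ultrafilter_def eventually_False)
    qed
    ultimately have "Suc k \<le> card (solutions N p bs)"
      using card_inj_on_le[of c "{..k}" "solutions N p bs"] fin by (simp add: image_subset_iff)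
    then show False by (simp add: k_def)
  qed
qed

lemma card_univ_unbounded:
  assumes "infinite (univ N)"
  shows "eventually (\<lambda>i. k \<le> card (univ (M i))) U"
proof -
  have "solutions A (Eq (Var 0) (Var 0)) bs = univ A" for A :: "('x, 'f, 'r) struct" and bs
    by (simp add: solutions_def)
  then show ?thesis
    using infinite_solutions_iff[of "[]" "Eq (Var 0) (Var 0)"] assms by (simp add: formula_xy_def solutions_def)
qed

end

text \<open>Enumerate \<open>J\<close> and satisfy at each index the longest possible initial
  segment of conditions, of length at most \<open>g i\<close>. The cap makes the maximum exist, and
  as \<open>g\<close> is unbounded along \<open>U\<close> each condition lies in that segment almost
  everywhere. Both elements and lists will serve as points.\<close>

lemma countable_saturation:
  fixes P :: "'j \<Rightarrow> 'i \<Rightarrow> 'x \<Rightarrow> bool" and g :: "'i \<Rightarrow> nat"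
  assumes J: "countable J" and g: "\<And>k. eventually (\<lambda>i. k \<le> g i) U"
    and fin: "\<And>F. finite F \<Longrightarrow> F \<subseteq> J \<Longrightarrow> eventually (\<lambda>i. \<exists>x. \<forall>j\<in>F. P j i x) U"
  shows "\<exists>f. \<forall>j\<in>J. eventually (\<lambda>i. P j i (f i)) U"
proof (cases "J = {}")
  case False
  define e where "e = from_nat_into J"
  define Q where "Q k i x \<longleftrightarrow> (\<forall>l<k. P (e l) i x)" for k i x
  define d where "d i = Max {k. k \<le> g i \<and> (\<exists>x. Q k i x)}" for i
  define f where "f i = (SOME x. Q (d i) i x)" for i
  have fin_set: "finite {k. k \<le> g i \<and> (\<exists>x. Q k i x)}" for i by simp
  have "d i \<in> {k. k \<le> g i \<and> (\<exists>x. Q k i x)}" for i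
  proof -
    have "0 \<in> {k. k \<le> g i \<and> (\<exists>x. Q k i x)}" by (simp add: Q_def)
    then show ?thesis unfolding d_def by (intro Max_in[OF fin_set]) blast
  qed
  then have "\<exists>x. Q (d i) i x" for i by simp
  then have f: "Q (d i) i (f i)" for i unfolding f_def by (rule someI_ex)
  have "eventually (\<lambda>i. P j i (f i)) U" if j: "j \<in> J" for j
  proof -
    obtain l where l: "j = e l" using from_nat_into_surj[OF J j] by (auto simp: e_def)
    have "e ` {..<Suc l} \<subseteq> J" using from_nat_into[OF False] by (auto simp: e_def)
    then have "eventually (\<lambda>i. \<exists>x. \<forall>j\<in>e ` {..<Suc l}. P j i x) U" by (intro fin) auto
    moreover have "eventually (\<lambda>i. Suc l \<le> g i) U" by (rule g)
    ultimately show ?thesis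
    proof eventually_elim
      case (elim i)
      then have "Suc l \<le> d i"
        unfolding d_def by (intro Max_ge[OF fin_set]) (auto simp: Q_def)
      then show ?case using f[of i] by (auto simp: Q_def l)
    qed
  qed
  then show ?thesis by blast
qed simp

section \<open>Ultraproducts of members of an asymptotic class\<close>

locale class_ultraproduct = finite_struct_family L U M
  for L :: "('f, 'r) lang" and U :: "'i filter" and M :: "'i \<Rightarrow> ('a, 'f, 'r) struct" +
  fixes K :: "('a, 'f, 'r) struct set"
  assumes countable_L: "countable_lang L" and class_K: "asymptotic_class_1 L K"
    and M_in_K: "\<And>i. M i \<in> K" and infinite_N: "infinite (univ N)"
begin

text \<open>The greedy lists and algebraicity in the ultraproduct must refer to the same bound, so
  it is fixed once per formula; the other data of the dichotomy can be picked anew at each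
  use.\<close>

definition threshold :: "nat \<Rightarrow> ('f, 'r) fm \<Rightarrow> nat" where
  "threshold m p = (SOME C. \<exists>n0 \<delta> q. dichotomy L K m p C n0 \<delta> q)"

lemma threshold_dichotomy:
  assumes "formula_xy L m p"
  obtains n0 \<delta> q where "dichotomy L K m p (threshold m p) n0 \<delta> q"
proof -
  have "\<exists>n0 \<delta> q. dichotomy L K m p (threshold m p) n0 \<delta> q"
    using someI_ex[OF uniform_dichotomy[OF class_K assms]] unfolding threshold_def .
  then show ?thesis using that by blast
qed

lemma dichotomy_iff:
  assumes "dichotomy L K m p C n0 \<delta> q" "n0 \<le> card (univ (M i))" "bs \<in> lists (univ (M i))" "length bs = m"
  shows "sat (M i) (params bs) q \<longleftrightarrow> C \<le> card (solutions (M i) p bs)"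
proof -
  have "if sat (M i) (params bs) q
        then C \<le> card (solutions (M i) p bs) \<and> \<delta> * card (univ (M i)) \<le> card (solutions (M i) p bs)
        else card (solutions (M i) p bs) < C"
    using assms M_in_K[of i] unfolding dichotomy_def by blast
  then show ?thesis by (simp split: if_splits)
qed

lemma dichotomy_large:
  assumes "dichotomy L K m p C n0 \<delta> q" "n0 \<le> card (univ (M i))" "bs \<in> lists (univ (M i))" "length bs = m"
    "C \<le> card (solutions (M i) p bs)"
  shows "\<delta> * card (univ (M i)) \<le> card (solutions (M i) p bs)"
proof -
  have "if sat (M i) (params bs) q
        then C \<le> card (solutions (M i) p bs) \<and> \<delta> * card (univ (M i)) \<le> card (solutions (M i) p bs)
        else card (solutions (M i) p bs) < C"
    using assms(1-4) M_in_K[of i] unfolding dichotomy_def by blast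
  then show ?thesis using assms(5) by (simp split: if_splits)
qed

lemma dichotomy_pos: "dichotomy L K m p C n0 \<delta> q \<Longrightarrow> \<delta> > 0"
  by (simp add: dichotomy_def)

lemma dichotomy_formula: "dichotomy L K m p C n0 \<delta> q \<Longrightarrow> formula_y L m q"
  by (simp add: dichotomy_def)

lemma eventually_card_univ:
  assumes "eventually Q sequentially"
  shows "eventually (\<lambda>i. Q (card (univ (M i)))) U"
proof -
  obtain n0 where n0: "\<And>n. n0 \<le> n \<Longrightarrow> Q n" using assms by (auto simp: eventually_sequentially)
  have "eventually (\<lambda>i. n0 \<le> card (univ (M i))) U" by (rule card_univ_unbounded[OF infinite_N])
  then show ?thesis by eventually_elim (rule n0)
qed

text \<open>Finiteness is decided at one bound, whatever the parameters: a set reaching the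
  threshold contains a fixed proportion of its factor, and the factors are unbounded along
  \<open>U\<close>. This is the uniformity behind the elimination of the quantifier "there are
  infinitely many".\<close>

lemma finite_solutions_iff:
  assumes p: "formula_xy L (length bs) p" and bs: "bs \<in> lists (univ N)"
  shows "finite (solutions N p bs) \<longleftrightarrow>
    eventually (\<lambda>i. card (solutions (M i) p (map (coord i) bs)) < threshold (length bs) p) U"
    (is "_ \<longleftrightarrow> eventually (\<lambda>i. ?s i < ?t) U")
proof
  assume "finite (solutions N p bs)"
  then obtain k where k: "\<not> eventually (\<lambda>i. k \<le> ?s i) U"
    using infinite_solutions_iff[OF p bs] by blast
  obtain n0 \<delta> q where d: "dichotomy L K (length bs) p ?t n0 \<delta> q"
    using threshold_dichotomy[OF p] .
  note \<delta> = dichotomy_pos[OF d] dichotomy_large[OF d]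
  show "eventually (\<lambda>i. ?s i < ?t) U"
  proof (rule ccontr)
    assume "\<not> ?thesis"
    then have "eventually (\<lambda>i. ?t \<le> ?s i) U"
      using ultrafilter_not_eventually[OF ultra, of "\<lambda>i. ?s i < ?t"] by (simp add: not_less)
    moreover have "eventually (\<lambda>i. n0 \<le> card (univ (M i))) U"
      by (rule card_univ_unbounded[OF infinite_N])
    moreover have "eventually (\<lambda>i. nat \<lceil>k / \<delta>\<rceil> \<le> card (univ (M i))) U"
      by (rule card_univ_unbounded[OF infinite_N])
    ultimately have "eventually (\<lambda>i. k \<le> ?s i) U"
    proof eventually_elim
      case (elim i)
      have "\<delta> * card (univ (M i)) \<le> ?s i"
        using elim(1,2) map_coord_in_lists[OF bs] by (intro \<delta>(2)) auto
      moreover have "k / \<delta> \<le> card (univ (M i))" using elim(3) by linarith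
      then have "k \<le> \<delta> * card (univ (M i))" using \<delta>(1) by (simp add: field_simps)
      ultimately show ?case by linarith
    qed
    then show False using k by blast
  qed
next
  assume "eventually (\<lambda>i. ?s i < ?t) U"
  then have "eventually (\<lambda>i. \<not> ?t \<le> ?s i) U" by (simp add: not_le)
  then have "\<not> eventually (\<lambda>i. ?t \<le> ?s i) U"
    using ultrafilter_not_eventually[OF ultra, of "\<lambda>i. ?t \<le> ?s i"] by simp
  then show "finite (solutions N p bs)" using infinite_solutions_iff[OF p bs] by blast
qed

text \<open>The formula \<open>\<theta>\<close> is algebraic at \<open>c\<close> but may be large at
  other values y of that parameter; \<open>\<chi>\<close> therefore keeps only the y at which it is
  small, and reads the relation with y as object. Then \<open>\<xi>\<close> says of x that its
  \<open>\<chi>\<close>-fibre is large, and double counting makes it algebraic over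
  \<open>es\<close>. So \<open>a\<close> fails \<open>\<xi>\<close>, its fibre is small, and that
  fibre contains \<open>c\<close>.\<close>

theorem exchange:
  assumes a: "a \<in> univ N" and c: "c \<in> univ N" and es: "es \<in> lists (univ N)"
    and acl: "a \<in> acl L N (set (c # es))" and nacl: "a \<notin> acl L N (set es)"
  shows "c \<in> acl L N (set (a # es))"
proof -
  let ?m = "length es"
  obtain \<theta> where \<theta>: "formula_xy L (length (c # es)) \<theta>" "finite (solutions N \<theta> (c # es))"
      "a \<in> solutions N \<theta> (c # es)"
    using acl by (rule acl_over_list)
  have \<theta>_xy: "formula_xy L (Suc ?m) \<theta>" using \<theta>(1) by simp
  obtain n0 \<delta>0 q where d: "dichotomy L K (Suc ?m) \<theta> (threshold (Suc ?m) \<theta>) n0 \<delta>0 q"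
    using threshold_dichotomy[OF \<theta>_xy] .
  note q = dichotomy_formula[OF d] dichotomy_iff[OF d]
  \<comment> \<open>In \<open>\<theta>\<close> variable 0 is x and variable 1 is y;
    \<open>\<chi>\<close> exchanges the two.\<close>
  define swap :: "nat \<Rightarrow> nat" where "swap n = (if n = 0 then 1 else if n = 1 then 0 else n)" for n
  define \<chi> where "\<chi> = rename swap (And \<theta> (Neg q))"
  have "free_vars (And \<theta> (Neg q)) \<subseteq> {0..Suc ?m}"
    using \<theta>_xy q(1) by (auto simp: formula_xy_def formula_y_def)
  then have "free_vars \<chi> \<subseteq> swap ` {0..Suc ?m}"
    unfolding \<chi>_def using free_vars_rename by (meson image_mono order_trans)
  moreover have "swap ` {0..Suc ?m} \<subseteq> {0..Suc ?m}" by (auto simp: swap_def)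
  ultimately have \<chi>: "formula_xy L (Suc ?m) \<chi>"
    using \<theta>_xy q(1) by (auto simp: formula_xy_def formula_y_def \<chi>_def)
  obtain n1 \<delta> q' where d': "dichotomy L K (Suc ?m) \<chi> (threshold (Suc ?m) \<chi>) n1 \<delta> q'"
    using threshold_dichotomy[OF \<chi>] .
  note q' = dichotomy_formula[OF d'] dichotomy_iff[OF d']
  note \<delta> = dichotomy_pos[OF d'] dichotomy_large[OF d']
  \<comment> \<open>The first parameter of \<open>q'\<close> becomes the object variable of
    \<open>\<xi>\<close>; 0 and 1 are not confused because 0 is not free in
    \<open>q'\<close>.\<close>
  define \<xi> where "\<xi> = rename (\<lambda>n. n - 1) q'"
  have "free_vars \<xi> \<subseteq> (\<lambda>n. n - 1) ` {1..Suc ?m}"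
    unfolding \<xi>_def using free_vars_rename q'(1) unfolding formula_y_def
    by (meson image_mono order_trans)
  then have \<xi>: "formula_xy L ?m \<xi>"
    using q'(1) by (force simp: formula_xy_def formula_y_def \<xi>_def)

  have sat_q: "sat (M i) ((params (y # bs))(0 := x)) q = sat (M i) (params (y # bs)) q" for i x y bs
    using q(1) by (intro sat_cong) (auto simp: formula_y_def)
  have in_\<chi>: "y \<in> solutions (M i) \<chi> (x # bs) \<longleftrightarrow> x \<in> solutions (M i) \<theta> (y # bs) \<and>
      \<not> sat (M i) (params (y # bs)) q" if "x \<in> univ (M i)" "y \<in> univ (M i)" for i x y bs
  proof -
    have "(\<lambda>n. ((params (x # bs))(0 := y)) (swap n)) = (params (y # bs))(0 := x)"
      by (rule ext) (auto simp: params_def swap_def split: nat.splits)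
    then show ?thesis using that by (simp add: solutions_def \<chi>_def sat_rename sat_q)
  qed
  have in_\<xi>: "x \<in> solutions (M i) \<xi> bs \<longleftrightarrow> sat (M i) (params (x # bs)) q'"
    if "x \<in> univ (M i)" for i x bs
  proof -
    have "sat (M i) (\<lambda>n. ((params bs)(0 := x)) (n - 1)) q' = sat (M i) (params (x # bs)) q'"
      using q'(1) by (intro sat_cong) (auto simp: params_def formula_y_def split: nat.splits)
    then show ?thesis using that by (simp add: solutions_def \<xi>_def sat_rename)
  qed

  have bound: "\<delta> * card (solutions (M i) \<xi> bs) \<le> threshold (Suc ?m) \<theta>"
    if n: "n0 \<le> card (univ (M i))" "n1 \<le> card (univ (M i))"
      and bs: "bs \<in> lists (univ (M i))" "length bs = ?m" for i bs
  proof (rule card_large_fibres[where R = "\<lambda>x y. y \<in> solutions (M i) \<chi> (x # bs)"])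
    show "finite (univ (M i))" by (rule finite_M)
    show "univ (M i) \<noteq> {}" using struct_M by (simp add: is_struct_def)
    show "card {x \<in> univ (M i). y \<in> solutions (M i) \<chi> (x # bs)} \<le> threshold (Suc ?m) \<theta>"
      if y: "y \<in> univ (M i)" for y
    proof (cases "sat (M i) (params (y # bs)) q")
      case True
      then have "{x \<in> univ (M i). y \<in> solutions (M i) \<chi> (x # bs)} = {}" using in_\<chi> y by auto
      then show ?thesis by (simp only: card.empty)
    next
      case False
      then have "card (solutions (M i) \<theta> (y # bs)) \<le> threshold (Suc ?m) \<theta>"
        using q(2)[OF n(1), of "y # bs"] y bs by simp
      moreover have "card {x \<in> univ (M i). y \<in> solutions (M i) \<chi> (x # bs)} \<le>
          card (solutions (M i) \<theta> (y # bs))"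
        using in_\<chi> y by (intro card_mono finite_solutions_M) auto
      ultimately show ?thesis by linarith
    qed
    show "x \<in> univ (M i) \<and>
        \<delta> * card (univ (M i)) \<le> card {y \<in> univ (M i). y \<in> solutions (M i) \<chi> (x # bs)}"
      if "x \<in> solutions (M i) \<xi> bs" for x
    proof -
      have x: "x \<in> univ (M i)" using that by (simp add: solutions_def)
      then have "sat (M i) (params (x # bs)) q'" using in_\<xi> that by blast
      then have "threshold (Suc ?m) \<chi> \<le> card (solutions (M i) \<chi> (x # bs))"
        using q'(2)[OF n(2), of "x # bs"] x bs by simp
      then have "\<delta> * card (univ (M i)) \<le> card (solutions (M i) \<chi> (x # bs))"
        using x bs by (intro \<delta>(2)[OF n(2)]) auto
      moreover have "{y \<in> univ (M i). y \<in> solutions (M i) \<chi> (x # bs)} = solutions (M i) \<chi> (x # bs)"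
        by (auto simp: solutions_def)
      ultimately show ?thesis using x by simp
    qed
  qed
  note unbounded = card_univ_unbounded[OF infinite_N]
  have es_i: "map (coord i) es \<in> lists (univ (M i))" for i by (rule map_coord_in_lists[OF es])

  have "finite (solutions N \<xi> es)"
  proof (rule ccontr)
    assume "\<not> ?thesis"
    then have "eventually (\<lambda>i. Suc (nat \<lfloor>threshold (Suc ?m) \<theta> / \<delta>\<rfloor>) \<le>
        card (solutions (M i) \<xi> (map (coord i) es))) U"
      using infinite_solutions_iff[OF \<xi> es] by blast
    then have "eventually (\<lambda>i. False) U"
      using unbounded[of n0] unbounded[of n1]
    proof eventually_elim
      case (elim i)
      have "\<delta> * card (solutions (M i) \<xi> (map (coord i) es)) \<le> threshold (Suc ?m) \<theta>"
        using elim(2,3) es_i by (intro bound) auto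
      then have "card (solutions (M i) \<xi> (map (coord i) es)) \<le> threshold (Suc ?m) \<theta> / \<delta>"
        using \<delta>(1) by (simp add: field_simps)
      then show False using elim(1) by linarith
    qed
    then show False using ultra by (simp add: ultrafilter_def eventually_False)
  qed
  then have "a \<notin> solutions N \<xi> es" using nacl acl_listI[OF \<xi>] by blast
  then have "eventually (\<lambda>i. coord i a \<notin> solutions (M i) \<xi> (map (coord i) es)) U"
    using los_solutions[OF \<xi> es a] ultrafilter_not_eventually[OF ultra] by blast
  then have "eventually (\<lambda>i. card (solutions (M i) \<chi> (map (coord i) (a # es))) <
      threshold (length (a # es)) \<chi>) U"
    using unbounded[of n1]
  proof eventually_elim
    case (elim i)
    have "\<not> sat (M i) (params (coord i a # map (coord i) es)) q'"
      using elim(1) in_\<xi> coord_in_univ[OF a] by blast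
    then show ?case
      using q'(2)[OF elim(2), of "coord i a # map (coord i) es"] es_i coord_in_univ[OF a] by simp
  qed
  moreover have \<chi>': "formula_xy L (length (a # es)) \<chi>" and aes: "a # es \<in> lists (univ N)"
    using \<chi> a es by auto
  ultimately have "finite (solutions N \<chi> (a # es))" using finite_solutions_iff by blast
  moreover have "c \<in> solutions N \<chi> (a # es)"
  proof -
    have ces: "c # es \<in> lists (univ N)" using c es by simp
    have "eventually (\<lambda>i. card (solutions (M i) \<theta> (map (coord i) (c # es))) <
        threshold (length (c # es)) \<theta>) U"
      using finite_solutions_iff[OF \<theta>(1) ces] \<theta>(2) by blast
    moreover have "eventually (\<lambda>i. coord i a \<in> solutions (M i) \<theta> (map (coord i) (c # es))) U"
      using los_solutions[OF \<theta>(1) ces a] \<theta>(3) by blast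
    ultimately have "eventually (\<lambda>i. coord i c \<in> solutions (M i) \<chi> (map (coord i) (a # es))) U"
      using unbounded[of n0]
    proof eventually_elim
      case (elim i)
      have "\<not> sat (M i) (params (coord i c # map (coord i) es)) q"
        using q(2)[OF elim(3), of "coord i c # map (coord i) es"] elim(1) es_i coord_in_univ[OF c]
        by simp
      then show ?case
        using elim(2) in_\<chi>[OF coord_in_univ[OF a] coord_in_univ[OF c]] by simp
    qed
    then show ?thesis using los_solutions[OF \<chi>' aes c] by blast
  qed
  ultimately show ?thesis by (rule acl_listI[OF \<chi>'])
qed

section \<open>Realizing types together with conditions on coordinates\<close>

lemma type_finite_part:
  assumes A: "A \<subseteq> univ N" and q: "q \<in> types1 L N A" "non_algebraic N q" and F: "finite F" "F \<subseteq> q"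
  obtains p bs where "(p, bs) \<in> formulas_over L A" "infinite (solutions N p bs)"
    "\<And>i p' bs'. (p', bs') \<in> F \<Longrightarrow>
       solutions (M i) p (map (coord i) bs) \<subseteq> solutions (M i) p' (map (coord i) bs')"
proof -
  have q_sub: "q \<subseteq> formulas_over L A" using q(1) by (simp add: types1_def)
  obtain p bs where p: "(p, bs) \<in> formulas_over L A"
    and sol: "\<And>(g :: ('i \<Rightarrow> 'a) set \<Rightarrow> 'a) A. solutions A p (map g bs) =
       {x \<in> univ A. \<forall>(p', bs')\<in>F. x \<in> solutions A p' (map g bs')}"
    using formulas_over_conj[OF F(1), of L A] F(2) q_sub by blast
  have p_xy: "formula_xy L (length bs) p" and bs: "bs \<in> lists (univ N)"
    using p A by (auto simp: formulas_over_def)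
  \<comment> \<open>Closure under conjunction is not built into \<open>types1\<close>. If
    \<open>p\<close> were missing, its negation would be in \<open>q\<close>, and a common
    realization of that negation and \<open>F\<close> would satisfy \<open>p\<close> by Los.\<close>
  have "(p, bs) \<in> q"
  proof (rule ccontr)
    assume "(p, bs) \<notin> q"
    then have "(Neg p, bs) \<in> q" using q(1) p by (auto simp: types1_def)
    then have "finite (insert (Neg p, bs) F) \<and> insert (Neg p, bs) F \<subseteq> q" using F by simp
    then obtain a where a: "a \<in> univ N" "realizes N a (insert (Neg p, bs) F)"
      using q(1) unfolding types1_def by blast
    have "eventually (\<lambda>i. case x of (p', bs') \<Rightarrow>
        coord i a \<in> solutions (M i) p' (map (coord i) bs')) U" if "x \<in> F" for x
    proof -
      obtain p' bs' where x: "x = (p', bs')" by (cases x)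
      then have "formula_xy L (length bs') p'" "bs' \<in> lists (univ N)"
        using that F(2) q_sub A by (auto simp: formulas_over_def)
      moreover have "a \<in> solutions N p' bs'" using a(2) that x by (auto simp: realizes_def)
      ultimately show ?thesis using los_solutions[of bs' p' a] a(1) x by simp
    qed
    then have "eventually (\<lambda>i. \<forall>x\<in>F. case x of (p', bs') \<Rightarrow>
        coord i a \<in> solutions (M i) p' (map (coord i) bs')) U"
      using F(1) by (intro eventually_ball_finite) auto
    then have "eventually (\<lambda>i. coord i a \<in> solutions (M i) p (map (coord i) bs)) U"
      by eventually_elim (use coord_in_univ[OF a(1)] in \<open>auto simp: sol\<close>)
    then have "a \<in> solutions N p bs" using los_solutions[OF p_xy bs a(1)] by blast
    then show False using a(2) by (simp add: realizes_def solutions_def)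
  qed
  then have "infinite (solutions N p bs)" using q(2) by (auto simp: non_algebraic_def)
  moreover have "solutions (M i) p (map (coord i) bs) \<subseteq> solutions (M i) p' (map (coord i) bs')"
    if "(p', bs') \<in> F" for i p' bs'
    using that by (auto simp: sol)
  ultimately show ?thesis using that p by blast
qed

text \<open>The conditions \<open>R\<close> say what the realization must do besides: lie in the
  lists for density, avoid the closures for extension. It suffices that finitely many can be met
  almost everywhere inside each infinite set definable over \<open>A\<close>; saturation treats
  formulas and conditions together.\<close>

lemma realize_type:
  fixes R :: "'k \<Rightarrow> 'i \<Rightarrow> 'a \<Rightarrow> bool"
  assumes A: "A \<subseteq> univ N" "countable A" and q: "q \<in> types1 L N A" "non_algebraic N q"
    and J: "countable J"
    and R: "\<And>p bs G. (p, bs) \<in> formulas_over L A \<Longrightarrow> infinite (solutions N p bs) \<Longrightarrow> finite G \<Longrightarrow>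
      G \<subseteq> J \<Longrightarrow> eventually (\<lambda>i. \<exists>x\<in>solutions (M i) p (map (coord i) bs). \<forall>k\<in>G. R k i x) U"
  obtains a where "a \<in> univ N" "realizes N a q" "\<And>k. k \<in> J \<Longrightarrow> eventually (\<lambda>i. R k i (coord i a)) U"
proof -
  have q_sub: "q \<subseteq> formulas_over L A" using q(1) by (simp add: types1_def)
  define P where "P j i x = (case j of Inl (p, bs) \<Rightarrow> x \<in> solutions (M i) p (map (coord i) bs)
      | Inr k \<Rightarrow> R k i x)" for j i x
  have "countable q"
    using countable_subset[OF q_sub countable_formulas_over[OF countable_L A(2)]] .
  then have "countable (q <+> J)" using J unfolding Plus_def by (intro countable_Un countable_image)
  moreover have "eventually (\<lambda>i. \<exists>x. \<forall>j\<in>F. P j i x) U" if F: "finite F" "F \<subseteq> q <+> J" for F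
  proof -
    define F1 where "F1 = Inl -` F"
    define F2 where "F2 = Inr -` F"
    have F1: "finite F1" "F1 \<subseteq> q" and F2: "finite F2" "F2 \<subseteq> J"
      unfolding F1_def F2_def using F by (auto intro: finite_vimageI)
    obtain p bs where p: "(p, bs) \<in> formulas_over L A" "infinite (solutions N p bs)"
      "\<And>i p' bs'. (p', bs') \<in> F1 \<Longrightarrow>
       solutions (M i) p (map (coord i) bs) \<subseteq> solutions (M i) p' (map (coord i) bs')"
      using type_finite_part[OF A(1) q F1] by blast
    from R[OF p(1,2) F2] show ?thesis
    proof eventually_elim
      case (elim i)
      then obtain x where x: "x \<in> solutions (M i) p (map (coord i) bs)" "\<forall>k\<in>F2. R k i x" by blast
      have "P j i x" if "j \<in> F" for j
        using that p(3)[of _ _ i] x by (cases j) (auto simp: P_def F1_def F2_def)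
      then show ?case by blast
    qed
  qed
  ultimately obtain f where f: "\<And>j. j \<in> q <+> J \<Longrightarrow> eventually (\<lambda>i. P j i (f i)) U"
    using countable_saturation[of "q <+> J" "\<lambda>i. card (univ (M i))" U P]
      card_univ_unbounded[OF infinite_N] by blast
  have f_sol: "eventually (\<lambda>i. f i \<in> solutions (M i) p (map (coord i) bs)) U" if "(p, bs) \<in> q" for p bs
    using f[of "Inl (p, bs)"] that by (simp add: P_def InlI)
  have f_R: "eventually (\<lambda>i. R k i (f i)) U" if "k \<in> J" for k
    using f[of "Inr k"] that by (simp add: P_def InrI)
  obtain u where u: "\<And>i. u i \<in> univ (M i)" using some_in_univ by blast
  define f' where "f' i = (if f i \<in> univ (M i) then f i else u i)" for i
  have f': "f' i \<in> univ (M i)" for i by (simp add: f'_def u)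
  \<comment> \<open>Deciding \<open>x = x\<close> shows that \<open>q\<close> has a member, and any
    member forces \<open>f i\<close> into the universe almost everywhere; there \<open>f'\<close>
    agrees with \<open>f\<close>.\<close>
  have "(Eq (Var 0) (Var 0), []) \<in> formulas_over L A" by (simp add: formulas_over_def formula_xy_def)
  then obtain p0 bs0 where "(p0, bs0) \<in> q" using q(1) by (auto simp: types1_def)
  from f_sol[OF this] have "eventually (\<lambda>i. f' i = f i) U"
    by eventually_elim (simp add: f'_def solutions_def)
  with rep_cls(2)[of f', OF f'] have eq: "eventually (\<lambda>i. coord i (cls f') = f i) U"
    by eventually_elim simp
  have a: "cls f' \<in> univ N" using f' by (rule cls_in_univ)
  show ?thesis
  proof (rule that[OF a])
    show "realizes N (cls f') q"
      unfolding realizes_def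
    proof clarify
      fix p bs assume pq: "(p, bs) \<in> q"
      then have "formula_xy L (length bs) p" "bs \<in> lists (univ N)"
        using q_sub A(1) by (auto simp: formulas_over_def)
      moreover have "eventually (\<lambda>i. coord i (cls f') \<in> solutions (M i) p (map (coord i) bs)) U"
        using f_sol[OF pq] eq by eventually_elim simp
      ultimately show "cls f' \<in> solutions N p bs" using los_solutions a by blast
    qed
    show "eventually (\<lambda>i. R k i (coord i (cls f'))) U" if "k \<in> J" for k
      using f_R[OF that] eq by eventually_elim simp
  qed
qed

text \<open>A finite-dimensional set may be infinite, but it lies in the closure of a finite set,
  which is countable because the language is. So a type over it consists of countably many
  formulas.\<close>

lemma countable_finite_dimensional:
  assumes "finite_dimensional L N A"
  shows "A \<subseteq> univ N" "countable A"
proof -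
  show "A \<subseteq> univ N" using assms by (simp add: finite_dimensional_def)
  obtain as where "A \<subseteq> acl L N (set as)" using assms by (auto simp: finite_dimensional_def)
  then show "countable A"
    using countable_acl[OF countable_L, of "set as"] countable_subset by (auto intro: countable_finite)
qed

section \<open>Lists that are good for every formula\<close>

definition good_list :: "nat \<times> ('f, 'r) fm \<Rightarrow> 'i \<Rightarrow> 'a list \<Rightarrow> bool" where
  "good_list = (\<lambda>(m, p) i hs. set hs \<subseteq> univ (M i) \<and> length hs \<le> budget (card (univ (M i))) \<and>
     (\<forall>bs\<in>lists (univ (M i)). length bs = m \<and> threshold m p \<le> card (solutions (M i) p bs) \<longrightarrow>
        solutions (M i) p bs \<inter> set hs \<noteq> {}) \<and>
     avoids (small_union m (threshold m p) (solutions (M i) p)) hs)"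

definition good_lists :: "('i \<Rightarrow> 'a list) \<Rightarrow> bool" where
  "good_lists hs \<longleftrightarrow> (\<forall>m p. formula_xy L m p \<longrightarrow> eventually (\<lambda>i. good_list (m, p) i (hs i)) U)"

text \<open>Saturation with lists as points turns the greedy lists for finitely many formulas into
  one list per index that is good for each formula almost everywhere, the exceptional indices
  depending on the formula. \<open>good_list\<close> takes a pair so that it has the shape of a
  condition there.\<close>

lemma good_lists_exist: "\<exists>hs. good_lists hs"
proof -
  let ?J = "{(m, p). formula_xy L m p}"
  have "countable ?J"
    by (rule countable_subset[of _ "UNIV \<times> {p. wf_fm L p}"])
       (auto simp: formula_xy_def intro!: countable_SIGMA countable_wf_fm countable_L)
  moreover have "eventually (\<lambda>i. \<exists>hs. \<forall>j\<in>F. good_list j i hs) U" if F: "finite F" "F \<subseteq> ?J" for F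
  proof -
    have "\<forall>j\<in>F. \<exists>n0 \<delta>. (\<delta> :: real) > 0 \<and> (\<forall>i bs. n0 \<le> card (univ (M i)) \<longrightarrow> bs \<in> lists (univ (M i)) \<longrightarrow>
        length bs = fst j \<longrightarrow> threshold (fst j) (snd j) \<le> card (solutions (M i) (snd j) bs) \<longrightarrow>
        \<delta> * card (univ (M i)) \<le> card (solutions (M i) (snd j) bs))"
    proof
      fix j assume "j \<in> F"
      then have j: "formula_xy L (fst j) (snd j)" using F(2) by auto
      obtain n0 \<delta> q where d: "dichotomy L K (fst j) (snd j) (threshold (fst j) (snd j)) n0 \<delta> q"
        using threshold_dichotomy[OF j] .
      show "\<exists>n0 \<delta>. (\<delta> :: real) > 0 \<and> (\<forall>i bs. n0 \<le> card (univ (M i)) \<longrightarrow> bs \<in> lists (univ (M i)) \<longrightarrow>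
        length bs = fst j \<longrightarrow> threshold (fst j) (snd j) \<le> card (solutions (M i) (snd j) bs) \<longrightarrow>
        \<delta> * card (univ (M i)) \<le> card (solutions (M i) (snd j) bs))"
        using dichotomy_pos[OF d] dichotomy_large[OF d] by blast
    qed
    then obtain n0 and \<delta> :: "nat \<times> ('f, 'r) fm \<Rightarrow> real" where \<delta>: "\<And>j. j \<in> F \<Longrightarrow> \<delta> j > 0"
      "\<And>j i bs. j \<in> F \<Longrightarrow> n0 j \<le> card (univ (M i)) \<Longrightarrow> bs \<in> lists (univ (M i)) \<Longrightarrow> length bs = fst j \<Longrightarrow>
        threshold (fst j) (snd j) \<le> card (solutions (M i) (snd j) bs) \<Longrightarrow>
        \<delta> j * card (univ (M i)) \<le> card (solutions (M i) (snd j) bs)"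
      by metis
    obtain n1 :: nat where n1: "\<And>(V :: 'a set) S. finite V \<Longrightarrow> n1 \<le> card V \<Longrightarrow>
      (\<And>j bs. j \<in> F \<Longrightarrow> S j bs \<subseteq> V) \<Longrightarrow>
      (\<And>j bs. j \<in> F \<Longrightarrow> bs \<in> lists V \<Longrightarrow> length bs = fst j \<Longrightarrow>
         card (S j bs) < threshold (fst j) (snd j) \<or> \<delta> j * card V \<le> card (S j bs)) \<Longrightarrow>
      \<exists>hs. set hs \<subseteq> V \<and> length hs \<le> budget (card V) \<and>
        (\<forall>j\<in>F. (\<forall>bs\<in>lists V. length bs = fst j \<and> threshold (fst j) (snd j) \<le> card (S j bs) \<longrightarrow>
                  S j bs \<inter> set hs \<noteq> {}) \<and>
               avoids (small_union (fst j) (threshold (fst j) (snd j)) (S j)) hs)"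
      using independent_hitting_list[of F \<delta> fst "\<lambda>j. threshold (fst j) (snd j)"] F(1) \<delta>(1) by blast
    have "eventually (\<lambda>i. \<forall>j\<in>F. n0 j \<le> card (univ (M i))) U"
      using F(1) card_univ_unbounded[OF infinite_N] by (intro eventually_ball_finite) auto
    moreover have "eventually (\<lambda>i. n1 \<le> card (univ (M i))) U"
      by (rule card_univ_unbounded[OF infinite_N])
    ultimately show ?thesis
    proof eventually_elim
      case (elim i)
      have "\<exists>hs. set hs \<subseteq> univ (M i) \<and> length hs \<le> budget (card (univ (M i))) \<and>
        (\<forall>j\<in>F. (\<forall>bs\<in>lists (univ (M i)). length bs = fst j \<and>
                  threshold (fst j) (snd j) \<le> card (solutions (M i) (snd j) bs) \<longrightarrow>
                  solutions (M i) (snd j) bs \<inter> set hs \<noteq> {}) \<and>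
               avoids (small_union (fst j) (threshold (fst j) (snd j)) (solutions (M i) (snd j))) hs)"
      proof (rule n1)
        show "finite (univ (M i))" by (rule finite_M)
        show "n1 \<le> card (univ (M i))" by (rule elim(2))
        show "solutions (M i) (snd j) bs \<subseteq> univ (M i)" for j :: "nat \<times> ('f, 'r) fm" and bs
          by (auto simp: solutions_def)
        show "card (solutions (M i) (snd j) bs) < threshold (fst j) (snd j) \<or>
            \<delta> j * card (univ (M i)) \<le> card (solutions (M i) (snd j) bs)"
          if "j \<in> F" "bs \<in> lists (univ (M i))" "length bs = fst j" for j bs
          using \<delta>(2)[OF that(1) _ that(2,3)] elim(1) that(1) by (meson not_less)
      qed
      then show ?case unfolding good_list_def split_def by blast
    qed
  qed
  ultimately obtain hs where hs: "\<forall>j\<in>?J. eventually (\<lambda>i. good_list j i (hs i)) U"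
    using countable_saturation[of ?J "\<lambda>i. card (univ (M i))" U good_list]
      card_univ_unbounded[OF infinite_N] by blast
  have "good_lists hs" unfolding good_lists_def using hs by simp
  then show ?thesis by blast
qed

section \<open>The limit of the lists: independence, density, extension\<close>

definition limit_H :: "('i \<Rightarrow> 'a list) \<Rightarrow> ('i \<Rightarrow> 'a) set set" where
  "limit_H hs = {a \<in> univ N. eventually (\<lambda>i. coord i a \<in> set (hs i)) U}"

context
  fixes hs :: "'i \<Rightarrow> 'a list"
  assumes good_lists: "good_lists hs"
begin

lemma good: "formula_xy L m p \<Longrightarrow> eventually (\<lambda>i. good_list (m, p) i (hs i)) U"
  using good_lists by (simp add: good_lists_def)

text \<open>The order in which the coordinates of \<open>S\<close> were chosen may change with the
  index. As \<open>S\<close> is finite, one \<open>c\<close> is the latest at almost all indices,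
  and there it was chosen outside the bounded sets over the others.\<close>

lemma limit_H_last:
  assumes S: "finite S" "S \<subseteq> limit_H hs" "S \<noteq> {}"
  shows "\<exists>c\<in>S. c \<notin> acl L N (S - {c})"
proof -
  have S_univ: "S \<subseteq> univ N" using S(2) by (auto simp: limit_H_def)
  have "eventually (\<lambda>i. \<forall>c\<in>S. coord i c \<in> set (hs i)) U"
    using S by (intro eventually_ball_finite) (auto simp: limit_H_def)
  then have "eventually (\<lambda>i. \<exists>c\<in>S. \<exists>ys zs. hs i = ys @ coord i c # zs \<and> coord i ` (S - {c}) \<subseteq> set zs) U"
    using eventually_coord_inj[OF S(1) S_univ]
  proof eventually_elim
    case (elim i)
    have "\<exists>x\<in>set (hs i). x \<in> coord i ` S" using elim(1) S(3) by blast
    \<comment> \<open>Lists grow at the head, so the first entry coming from \<open>S\<close> is the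
      latest choice and the rest of \<open>S\<close> lies in \<open>zs\<close>.\<close>
    from split_list_first_prop[OF this] obtain ys x zs where
      split: "hs i = ys @ x # zs" "x \<in> coord i ` S" "\<forall>y\<in>set ys. y \<notin> coord i ` S" by blast
    then obtain c where c: "c \<in> S" "x = coord i c" by blast
    have "coord i b \<in> set zs" if "b \<in> S - {c}" for b
    proof -
      have "coord i b \<noteq> x" using elim(2) c that by (auto dest: inj_onD)
      moreover have "coord i b \<in> set (hs i)" "coord i b \<notin> set ys" using elim(1) split(3) that by auto
      ultimately show ?thesis using split(1) by auto
    qed
    then show ?case using c split(1) by blast
  qed
  from ultrafilter_eventually_bex[OF ultra S(1) this] obtain c where c: "c \<in> S"
    "eventually (\<lambda>i. \<exists>ys zs. hs i = ys @ coord i c # zs \<and> coord i ` (S - {c}) \<subseteq> set zs) U"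
    by blast
  have "c \<notin> acl L N (S - {c})"
  proof
    assume acl: "c \<in> acl L N (S - {c})"
    obtain bs where bs: "set bs = S - {c}" using finite_list[of "S - {c}"] S(1) by auto
    then obtain p where p: "formula_xy L (length bs) p" "finite (solutions N p bs)" "c \<in> solutions N p bs"
      using acl acl_over_list by metis
    have bs_univ: "bs \<in> lists (univ N)" using bs S_univ by auto
    have "eventually (\<lambda>i. card (solutions (M i) p (map (coord i) bs)) < threshold (length bs) p) U"
      using finite_solutions_iff[OF p(1) bs_univ] p(2) by blast
    moreover have "eventually (\<lambda>i. coord i c \<in> solutions (M i) p (map (coord i) bs)) U"
      using los_solutions[OF p(1) bs_univ] p(3) c(1) S_univ by blast
    ultimately have "eventually (\<lambda>i. False) U"
      using c(2) good[OF p(1)]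
    proof eventually_elim
      case (elim i)
      obtain ys zs where split: "hs i = ys @ coord i c # zs" "coord i ` (S - {c}) \<subseteq> set zs"
        using elim(3) by blast
      have "avoids (small_union (length bs) (threshold (length bs) p) (solutions (M i) p)) (coord i c # zs)"
        using elim(4) split(1) by (auto simp: good_list_def dest: avoids_append)
      then have "coord i c \<notin> small_union (length bs) (threshold (length bs) p) (solutions (M i) p) (set zs)"
        by simp
      moreover have "map (coord i) bs \<in> lists (set zs)" using split(2) bs by auto
      ultimately show False using elim(1,2) by (auto simp: small_union_def)
    qed
    then show False using ultra by (simp add: ultrafilter_def eventually_False)
  qed
  then show ?thesis using c(1) by blast
qed

text \<open>Remove the latest element \<open>c\<close>. A dependence of another \<open>a\<close> on
  the rest must involve \<open>c\<close>, since \<open>S - {c}\<close> is independent by induction,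
  so exchange turns it into a dependence of \<open>c\<close> on the rest.\<close>

lemma limit_H_finite_independent:
  assumes "finite S" "S \<subseteq> limit_H hs"
  shows "a \<in> S \<Longrightarrow> a \<notin> acl L N (S - {a})"
  using assms
proof (induction S arbitrary: a rule: finite_psubset_induct)
  case (psubset S)
  have S_univ: "S \<subseteq> univ N" using psubset.prems by (auto simp: limit_H_def)
  obtain c where c: "c \<in> S" "c \<notin> acl L N (S - {c})"
    using limit_H_last[of S] psubset by blast
  show ?case
  proof
    assume acl: "a \<in> acl L N (S - {a})"
    then have ac: "a \<noteq> c" using c by blast
    obtain es where es: "set es = S - {a, c}" using finite_list[of "S - {a, c}"] psubset.hyps by auto
    have eqs: "S - {c} - {a} = set es" "S - {a} = set (c # es)" "S - {c} = set (a # es)"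
      using es c(1) ac psubset.prems(1) by auto
    have "a \<notin> acl L N (S - {c} - {a})"
      by (rule psubset.IH) (use c(1) ac psubset.prems in auto)
    then have "c \<in> acl L N (set (a # es))"
      using acl es S_univ c(1) psubset.prems(1) unfolding eqs
      by (intro exchange[of a c es]) auto
    then have "c \<in> acl L N (S - {c})" using eqs(3) by simp
    then show False using c(2) by blast
  qed
qed

lemma limit_H_independent: "acl_independent L N (limit_H hs)"
  unfolding acl_independent_def
proof (intro ballI notI)
  fix x assume x: "x \<in> limit_H hs" "x \<in> acl L N (limit_H hs - {x})"
  then obtain p bs where p: "bs \<in> lists (limit_H hs - {x})" "formula_xy L (length bs) p"
      "finite (solutions N p bs)" "x \<in> solutions N p bs"
    unfolding acl_def by blast
  then have "x \<in> acl L N (set bs)" by (intro acl_listI)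
  moreover have "set bs = insert x (set bs) - {x}" using p(1) by auto
  ultimately show False using limit_H_finite_independent[of "insert x (set bs)" x] x(1) p(1) by auto
qed

text \<open>An infinite definable set reaches the threshold almost everywhere, and good lists meet
  all such sets. Membership in the list is the single side condition, indexed by
  \<open>unit\<close>.\<close>

lemma limit_H_dense:
  assumes A: "finite_dimensional L N A" and q: "q \<in> types1 L N A" "non_algebraic N q"
  shows "\<exists>a\<in>limit_H hs. realizes N a q"
proof -
  note A' = countable_finite_dimensional[OF A]
  obtain a where "a \<in> univ N" "realizes N a q"
    "\<And>k. k \<in> {()} \<Longrightarrow> eventually (\<lambda>i. coord i a \<in> set (hs i)) U"
  proof (rule realize_type[OF A' q, of "{()}" "\<lambda>_ i x. x \<in> set (hs i)"])
    fix p bs and G :: "unit set"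
    assume p: "(p, bs) \<in> formulas_over L A" "infinite (solutions N p bs)"
    then have p': "formula_xy L (length bs) p" "bs \<in> lists (univ N)"
      using A'(1) by (auto simp: formulas_over_def)
    have "eventually (\<lambda>i. threshold (length bs) p \<le> card (solutions (M i) p (map (coord i) bs))) U"
      using infinite_solutions_iff[OF p'] p(2) by blast
    then show "eventually (\<lambda>i. \<exists>x\<in>solutions (M i) p (map (coord i) bs). \<forall>k\<in>G. x \<in> set (hs i)) U"
      using good[OF p'(1)]
    proof eventually_elim
      case (elim i)
      then have "solutions (M i) p (map (coord i) bs) \<inter> set (hs i) \<noteq> {}"
        using map_coord_in_lists[OF p'(2), of i] unfolding good_list_def prod.case
        by (metis length_map)
      then show ?case by blast
    qed
  qed auto
  then show ?thesis by (auto simp: limit_H_def)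
qed

text \<open>An index \<open>(p, as, l)\<close> stands for \<open>p\<close> with fixed parameters
  \<open>as\<close> from \<open>A\<close> and \<open>l\<close> further ones ranging over the list.
  Its bounded instances cover at most a constant times \<open>budget n ^ l\<close> points, so
  finitely many indices cannot exhaust a set containing a fixed proportion of the factor.\<close>

lemma limit_H_extension:
  assumes A: "finite_dimensional L N A" and q: "q \<in> types1 L N A" "non_algebraic N q"
  shows "\<exists>a\<in>univ N. realizes N a q \<and> a \<notin> acl L N (A \<union> limit_H hs)"
proof -
  note A' = countable_finite_dimensional[OF A]
  let ?J = "{(p, as, l). as \<in> lists A \<and> formula_xy L (length as + l) p}"
  define B where "B = (\<lambda>(p, as, l) i. small_union l (threshold (length as + l) p)
      (\<lambda>ks. solutions (M i) p (map (coord i) as @ ks)) (set (hs i)))"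
  have J: "countable ?J"
    by (rule countable_subset[of _ "{p. wf_fm L p} \<times> lists A \<times> UNIV"])
       (auto simp: formula_xy_def intro!: countable_SIGMA countable_wf_fm countable_L A'(2))
  obtain a where a: "a \<in> univ N" "realizes N a q"
    "\<And>k. k \<in> ?J \<Longrightarrow> eventually (\<lambda>i. coord i a \<notin> B k i) U"
  proof (rule realize_type[OF A' q J, of "\<lambda>k i x. x \<notin> B k i"])
    fix p bs G
    assume p: "(p, bs) \<in> formulas_over L A" "infinite (solutions N p bs)"
      and G: "finite G" "G \<subseteq> ?J"
    then have p': "formula_xy L (length bs) p" "bs \<in> lists (univ N)"
      using A'(1) by (auto simp: formulas_over_def)
    obtain n0 \<delta> r where d: "dichotomy L K (length bs) p (threshold (length bs) p) n0 \<delta> r"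
      using threshold_dichotomy[OF p'(1)] .
    note \<delta> = dichotomy_pos[OF d] dichotomy_large[OF d]
    define t where "t = (\<lambda>(p :: ('f, 'r) fm, as :: ('i \<Rightarrow> 'a) set list, l). threshold (length as + l) p)"
    define l where "l = (\<lambda>(p :: ('f, 'r) fm, as :: ('i \<Rightarrow> 'a) set list, l :: nat). l)"
    have "(\<lambda>n. \<Sum>k\<in>G. real (t k) * (real (budget n) ^ l k / real n)) \<longlonglongrightarrow> (\<Sum>k\<in>G. real (t k) * 0)"
      by (intro tendsto_intros budget_power_sublinear)
    then have "eventually (\<lambda>n. (\<Sum>k\<in>G. real (t k) * (real (budget n) ^ l k / real n)) < \<delta>) sequentially"
      using \<delta> by (intro order_tendstoD(2)) auto
    then have "eventually (\<lambda>i. (\<Sum>k\<in>G. real (t k) *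
        (real (budget (card (univ (M i)))) ^ l k / real (card (univ (M i))))) < \<delta>) U"
      by (rule eventually_card_univ)
    moreover have "eventually (\<lambda>i. threshold (length bs) p \<le> card (solutions (M i) p (map (coord i) bs))) U"
      using infinite_solutions_iff[OF p'] p(2) by blast
    moreover have "eventually (\<lambda>i. n0 \<le> card (univ (M i))) U" "eventually (\<lambda>i. 1 \<le> card (univ (M i))) U"
      by (rule card_univ_unbounded[OF infinite_N])+
    ultimately show "eventually (\<lambda>i. \<exists>x\<in>solutions (M i) p (map (coord i) bs). \<forall>k\<in>G. x \<notin> B k i) U"
      using good[OF p'(1)]
    proof eventually_elim
      case (elim i)
      let ?n = "card (univ (M i))" and ?S = "solutions (M i) p (map (coord i) bs)"
      have "card (set (hs i)) \<le> budget ?n"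
        using elim(5) card_length[of "hs i"] by (auto simp: good_list_def)
      have B_card: "card (B k i) \<le> budget ?n ^ l k * t k" for k
      proof -
        have "card (B k i) \<le> card (set (hs i)) ^ l k * t k"
          unfolding B_def l_def t_def by (simp add: split_def card_small_union)
        also have "\<dots> \<le> budget ?n ^ l k * t k"
          using \<open>card (set (hs i)) \<le> budget ?n\<close> by (intro mult_right_mono power_mono) auto
        finally show ?thesis .
      qed
      have B_fin: "B k i \<subseteq> univ (M i)" for k
        unfolding B_def small_union_def by (auto simp: solutions_def split_def)
      have "card (\<Union>k\<in>G. B k i) \<le> (\<Sum>k\<in>G. card (B k i))" using G(1) by (rule card_UN_le)
      also have "\<dots> \<le> (\<Sum>k\<in>G. budget ?n ^ l k * t k)" by (intro sum_mono B_card)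
      finally have "real (card (\<Union>k\<in>G. B k i)) \<le> real (\<Sum>k\<in>G. budget ?n ^ l k * t k)"
        by (rule of_nat_mono)
      also have "\<dots> = (\<Sum>k\<in>G. real (t k) * (real (budget ?n) ^ l k / real ?n)) * ?n"
        unfolding sum_distrib_right of_nat_sum using elim(4) by (intro sum.cong) auto
      also have "\<dots> < \<delta> * ?n" using elim(1,4) by (intro mult_strict_right_mono) auto
      also have "\<dots> \<le> card ?S"
        using elim(2,3) map_coord_in_lists[OF p'(2)] by (intro \<delta>(2)) auto
      finally have "card (\<Union>k\<in>G. B k i) < card ?S" by simp
      moreover have "finite (\<Union>k\<in>G. B k i)"
        using G(1) B_fin finite_M[of i] finite_subset by blast
      ultimately have "\<not> ?S \<subseteq> (\<Union>k\<in>G. B k i)" using card_mono not_less by blast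
      then show ?case by blast
    qed
  qed blast
  have "a \<notin> acl L N (A \<union> limit_H hs)"
  proof
    assume "a \<in> acl L N (A \<union> limit_H hs)"
    then obtain p0 bs where bs: "bs \<in> lists (A \<union> limit_H hs)" "formula_xy L (length bs) p0"
        "finite (solutions N p0 bs)" "a \<in> solutions N p0 bs"
      unfolding acl_def by blast
    \<comment> \<open>Parameters from \<open>A\<close> are put first to fit the shape of an index;
      the others come from the limit set and so have coordinates in \<open>hs i\<close> almost
      everywhere.\<close>
    define as where "as = filter (\<lambda>b. b \<in> A) bs"
    define ks where "ks = filter (\<lambda>b. b \<notin> A) bs"
    have as: "as \<in> lists A" and ks: "ks \<in> lists (limit_H hs)" using bs(1) by (auto simp: as_def ks_def)
    have univ: "as @ ks \<in> lists (univ N)" using as ks A'(1) by (auto simp: limit_H_def)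
    have "set bs = set (as @ ks)" by (auto simp: as_def ks_def)
    moreover have "a \<in> acl L N (set bs)" using bs by (intro acl_listI)
    ultimately obtain p where p: "formula_xy L (length (as @ ks)) p" "finite (solutions N p (as @ ks))"
        "a \<in> solutions N p (as @ ks)"
      using acl_over_list by metis
    have "eventually (\<lambda>i. card (solutions (M i) p (map (coord i) (as @ ks))) < threshold (length (as @ ks)) p) U"
      using finite_solutions_iff[OF p(1) univ] p(2) by blast
    moreover have "eventually (\<lambda>i. coord i a \<in> solutions (M i) p (map (coord i) (as @ ks))) U"
      using los_solutions[OF p(1) univ a(1)] p(3) by blast
    moreover have "eventually (\<lambda>i. \<forall>k\<in>set ks. coord i k \<in> set (hs i)) U"
      using ks by (intro eventually_ball_finite) (auto simp: limit_H_def)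
    moreover have "eventually (\<lambda>i. coord i a \<notin> B (p, as, length ks) i) U"
      using as p(1) by (intro a(3)) simp
    ultimately have "eventually (\<lambda>i. False) U"
    proof eventually_elim
      case (elim i)
      have "map (coord i) ks \<in> lists (set (hs i))" using elim(3) by auto
      then show False using elim(1,2,4) by (auto simp: B_def small_union_def)
    qed
    then show False using ultra by (simp add: ultrafilter_def eventually_False)
  qed
  then show ?thesis using a(1,2) by blast
qed

end

section \<open>The expansion by the limit predicate\<close>

theorem H_expansion_exists:
  "\<exists>H. (\<forall>i. H i \<subseteq> univ (M i)) \<and> H_expansion_of L N (ultraproduct U (\<lambda>i. expand (M i) (H i)))"
proof -
  obtain hs where good: "good_lists hs"
    using good_lists_exist by blast
  \<comment> \<open>A list is known to stay in its factor only almost everywhere; intersecting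
    repairs the exceptional indices and does not change the limit, whose coordinates lie in the
    factors.\<close>
  define H where "H i = set (hs i) \<inter> univ (M i)" for i
  let ?N = "ultraproduct U (\<lambda>i. expand (M i) (H i))"
  \<comment> \<open>\<open>up_rel\<close> sees only the universes, so both ultraproducts have
    literally the same classes and representatives. Hence the reduct equals \<open>N\<close>, as
    \<open>H_expansion_of\<close> demands, and is not merely isomorphic to it.\<close>
  have up: "up_rel U (\<lambda>i. expand (M i) (H i)) = up_rel U M" by (simp add: up_rel_def expand_def)
  have reduct: "reduct ?N = N"
    by (simp add: reduct_def ultraproduct_def up) (simp add: expand_def)
  have univ: "univ ?N = univ N" and fun_int: "fun_int ?N = fun_int N"
    unfolding reduct[symmetric] by (simp_all add: reduct_def)
  have "rel_int ?N None [a] \<longleftrightarrow> eventually (\<lambda>i. coord i a \<in> H i) U" for a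
    by (simp add: ultraproduct_def expand_def)
  then have H_part: "H_part ?N = limit_H hs"
    unfolding H_part_def limit_H_def univ using coord_in_univ by (auto simp: H_def)
  have "is_struct (lang_H L) ?N"
    using is_struct_N unfolding is_struct_def univ fun_int by (simp add: lang_H_def)
  moreover have "models N (Th L N)" by (simp add: models_def Th_def)
  ultimately have "H_expansion_of L N ?N"
    unfolding H_expansion_of_def H_structure_def Let_def reduct H_part
    using limit_H_independent[OF good] limit_H_dense[OF good] limit_H_extension[OF good] by blast
  then show ?thesis by (intro exI[of _ H]) (auto simp: H_def)
qed

end

theorem mainTheorem3:
  fixes L :: "('f, 'r) lang"
    and K :: "('a, 'f, 'r) struct set"
    and U :: "'i filter"
    and M :: "'i \<Rightarrow> ('a, 'f, 'r) struct"
  assumes "countable_lang L"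
    and "asymptotic_class_1 L K"
    and "ultrafilter U"
    and "\<And>i. M i \<in> K"
    and "infinite (univ (ultraproduct U M))"
  shows "\<exists>H. (\<forall>i. H i \<subseteq> univ (M i)) \<and>
             H_expansion_of L (ultraproduct U M) (ultraproduct U (\<lambda>i. expand (M i) (H i)))"
proof -
  have "is_struct L (M i)" "finite (univ (M i))" for i
    using assms(2,4) unfolding asymptotic_class_1_def by blast+
  then interpret class_ultraproduct L U M K
    using assms by unfold_locales auto
  show ?thesis by (rule H_expansion_exists)
qed

end
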